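(* Let $\Gamma$ be a reduct of $(\mathbb{Z};<)$ with finite relational signature such that $\mathbb{Q}.\Gamma$ has rank one. Then $\mathrm{CSP}(\Gamma)=\mathrm{CSP}(\Delta)$ for a structure $\Delta$ (with the same signature) that is one of: (1) a finite structure; (2) a reduct of $(\mathbb{Z};<)$ in which $\mathrm{Dist}_k=\{(x,y):|x-y|=k\}$ is primitive positive definable for all $k\ge1$; (3) a reduct of $(\mathbb{Z};<)$ in which $\mathrm{suc}=\{(x,y):y=x+1\}$ is primitive positive definable.
   Context: A reduct of a structure $D$ is a relational structure with the same domain whose relations are first-order definable in $D$. $\mathrm{CSP}(\Gamma)$ is deciding truth in $\Gamma$ of primitive positive sentences; equal CSPs means same true pp-sentences. $\mathbb{Q}.\mathbb{Z}=\mathbb{Q}\times\mathbb{Z}$ with the lexicographic order, $(a,z)+k=(a,z+k)$; for $x,y\in\mathbb{Q}.\mathbb{Z}$, $|x-y|$ is the usual integer distance if $x,y$ lie in the same copy $\{a\}\times\mathbb{Z}$, and $\infty$ otherwise. $\mathbb{Q}.\Gamma$ interprets each relation symbol of $\Gamma$ by the relation defined over $(\mathbb{Q}.\mathbb{Z};<)$ by a first-order formula defining it over $(\mathbb{Z};<)$. A map $e\colon\mathbb{Q}.\mathbb{Z}\to\mathbb{Q}.\mathbb{Z}$ is $(k,c)$-bounded if $|e(u+k)-e(u)|\le c$ for all $u$, and $k$-bounded if it is $(k,c)$-bounded for some $c\in\mathbb{N}$. The rank of $\mathbb{Q}.\Gamma$ is the smallest $r\ge1$ such that every endomorphism of $\mathbb{Q}.\Gamma$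 is $r$-bounded. *)

theory Defs
  imports Complex_Main
begin

datatype fo = Less nat nat | Eq nat nat | Neg fo | Conj fo fo | Ex nat fo

fun fo_sat :: "('a \<Rightarrow> 'a \<Rightarrow> bool) \<Rightarrow> fo \<Rightarrow> (nat \<Rightarrow> 'a) \<Rightarrow> bool" where
  "fo_sat lt (Less x y) s = lt (s x) (s y)"
| "fo_sat lt (Eq x y) s = (s x = s y)"
| "fo_sat lt (Neg \<phi>) s = (\<not> fo_sat lt \<phi> s)"
| "fo_sat lt (Conj \<phi> \<psi>) s = (fo_sat lt \<phi> s \<and> fo_sat lt \<psi> s)"
| "fo_sat lt (Ex x \<phi>) s = (\<exists>a. fo_sat lt \<phi> (s(x := a)))"

text \<open>The n-ary relation defined by formula phi with free variables 0..<n
  (any other free variables are read existentially, which is again FO).\<close>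
definition fo_rel :: "('a \<Rightarrow> 'a \<Rightarrow> bool) \<Rightarrow> nat \<times> fo \<Rightarrow> 'a list set" where
  "fo_rel lt d = {xs. length xs = fst d \<and>
      (\<exists>s. (\<forall>i < fst d. s i = xs ! i) \<and> fo_sat lt (snd d) s)}"

text \<open>A structure: carrier and relations indexed by relation symbols 0,1,...;
  a signature is the list of arities.\<close>
type_synonym 'a struct = "'a set \<times> (nat \<Rightarrow> 'a list set)"

definition wf_struct :: "nat list \<Rightarrow> 'a struct \<Rightarrow> bool" where
  "wf_struct \<tau> A = (\<forall>i < length \<tau>. snd A i \<subseteq> {xs. length xs = \<tau> ! i \<and> set xs \<subseteq> fst A})"

text \<open>pp-formula: list of atoms R_i(vars) and list of equalities x = y, over variables nat.\<close>
type_synonym ppf = "(nat \<times> nat list) list \<times> (nat \<times> nat) list"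

definition wf_pp :: "nat list \<Rightarrow> ppf \<Rightarrow> bool" where
  "wf_pp \<tau> \<phi> = (\<forall>(i, vs) \<in> set (fst \<phi>). i < length \<tau> \<and> length vs = \<tau> ! i)"

definition pp_holds :: "'a struct \<Rightarrow> ppf \<Rightarrow> (nat \<Rightarrow> 'a) \<Rightarrow> bool" where
  "pp_holds A \<phi> s = ((\<forall>(i, vs) \<in> set (fst \<phi>). map s vs \<in> snd A i) \<and>
                      (\<forall>(x, y) \<in> set (snd \<phi>). s x = s y))"

definition pp_true :: "'a struct \<Rightarrow> ppf \<Rightarrow> bool" where
  "pp_true A \<phi> = (\<exists>s. range s \<subseteq> fst A \<and> pp_holds A \<phi> s)"

definition same_csp :: "nat list \<Rightarrow> 'a struct \<Rightarrow> 'b struct \<Rightarrow> bool" where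
  "same_csp \<tau> A B = (\<forall>\<phi>. wf_pp \<tau> \<phi> \<longrightarrow> (pp_true A \<phi> \<longleftrightarrow> pp_true B \<phi>))"

definition pp_definable :: "nat list \<Rightarrow> 'a struct \<Rightarrow> nat \<Rightarrow> 'a list set \<Rightarrow> bool" where
  "pp_definable \<tau> A m R = (\<exists>\<phi>. wf_pp \<tau> \<phi> \<and>
      R = {map s [0..<m] | s. range s \<subseteq> fst A \<and> pp_holds A \<phi> s})"

text \<open>A reduct of (Z;<) with finite relational signature is given by a list of
  (arity, defining formula) pairs.\<close>
definition sig :: "(nat \<times> fo) list \<Rightarrow> nat list" where
  "sig \<Phi> = map fst \<Phi>"

definition zstruct :: "(nat \<times> fo) list \<Rightarrow> int struct" where
  "zstruct \<Phi> = (UNIV, \<lambda>i. if i < length \<Phi> then fo_rel (\<lambda>x y. x < (y::int)) (\<Phi> ! i) else {})"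

type_synonym qz = "rat \<times> int"

definition qz_less :: "qz \<Rightarrow> qz \<Rightarrow> bool" where
  "qz_less u v = (fst u < fst v \<or> (fst u = fst v \<and> snd u < snd v))"

definition qz_shift :: "qz \<Rightarrow> int \<Rightarrow> qz" where
  "qz_shift u k = (fst u, snd u + k)"

definition qstruct :: "(nat \<times> fo) list \<Rightarrow> qz struct" where
  "qstruct \<Phi> = (UNIV, \<lambda>i. if i < length \<Phi> then fo_rel qz_less (\<Phi> ! i) else {})"

definition q_endo :: "(nat \<times> fo) list \<Rightarrow> (qz \<Rightarrow> qz) \<Rightarrow> bool" where
  "q_endo \<Phi> e = (\<forall>i < length \<Phi>. \<forall>xs \<in> snd (qstruct \<Phi>) i. map e xs \<in> snd (qstruct \<Phi>) i)"

text \<open>(k,c)-bounded: |e(u+k) - e(u)| <= c, where the distance is infinite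
  for points in different copies of Z.\<close>
definition kc_bounded :: "nat \<Rightarrow> nat \<Rightarrow> (qz \<Rightarrow> qz) \<Rightarrow> bool" where
  "kc_bounded k c e = (\<forall>u. fst (e (qz_shift u (int k))) = fst (e u) \<and>
                            \<bar>snd (e (qz_shift u (int k))) - snd (e u)\<bar> \<le> int c)"

definition k_bounded :: "nat \<Rightarrow> (qz \<Rightarrow> qz) \<Rightarrow> bool" where
  "k_bounded k e = (\<exists>c. kc_bounded k c e)"

definition has_rank :: "(nat \<times> fo) list \<Rightarrow> nat \<Rightarrow> bool" where
  "has_rank \<Phi> r = (1 \<le> r \<and> (\<forall>e. q_endo \<Phi> e \<longrightarrow> k_bounded r e) \<and>
      (\<forall>r'. 1 \<le> r' \<and> r' < r \<longrightarrow> \<not> (\<forall>e. q_endo \<Phi> e \<longrightarrow> k_bounded r' e)))"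

definition Dist :: "nat \<Rightarrow> int list set" where
  "Dist k = {[x, y] | x y. \<bar>x - y\<bar> = int k}"

definition suc_rel :: "int list set" where
  "suc_rel = {[x, x + 1] | x. True}"

end

theory Submission
  imports Defs "HOL-Library.FuncSet" "HOL-Library.Diagonal_Subsequence" "HOL-Library.Countable"
begin

text \<open>Compactness turns rank one into a property of the endomorphisms of \<open>\<Gamma>\<close> alone: maps
  \<open>\<int> \<Rightarrow> \<int>\<close> that are homomorphisms on growing intervals subconverge, up to translations, to an
  endomorphism of \<open>\<Gamma>\<close>. Hence the largest step \<open>k\<close> of an endomorphism exists, and extremality gives
  \<open>\<bar>f (x + k) - f x\<bar> \<le> k\<close> for all endomorphisms \<open>f\<close>. If all long intervals can be compressed, there
  is an endomorphism with finite range. Otherwise all endomorphisms are quasi-isometries with a common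
  constant, and the order-preserving ones satisfy \<open>f (x + k) = f x + k\<close> near both ends. Among the
  endomorphisms commuting with the shift by \<open>k\<close>, one that hits the fewest residue classes modulo \<open>k\<close>
  can be made idempotent; let \<open>S\<close> be its image. Order-preserving endomorphisms that map \<open>S\<close> to itself
  are then \<open>k\<close>-periodic on \<open>S\<close>, and their total displacement over a period is additive under
  composition. This forces them to be translations, and \<open>S\<close> to be an arithmetic progression.
  The structure induced on \<open>S\<close> is a reduct of \<open>(\<int>; <)\<close> with the same CSP whose endomorphisms are
  isometries of \<open>\<int>\<close>, and by compactness their orbits on pairs are primitive positive definable.\<close>

section \<open>Compact monoids of integer maps\<close>

text \<open>A bare sequence of maps on \<int> may have differences that diverge, and rank one says
  nothing about maps on \<int>. It applies only after the maps have been extended to Q.\<int>, which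
  is done by placing the copies in \<int> farther and farther apart. The limit is an endomorphism
  there because a definable relation sees differences only up to a fixed bound. The obstacle
  afterwards is that endomorphisms form a monoid, not a group: there are no inverses to cancel with.
  Powers replace them. A periodic map that is injective on the residue classes met by an invariant
  set permutes these classes, so some power is a translation on that set, and the preceding power is
  an inverse up to this translation. Injectivity comes from minimality of the number of classes.
  Periodicity in turn comes from extremality of \<open>k\<close>, which makes
  \<open>f (x + m * k) - m * k\<close> monotone in \<open>m\<close>. Uniform distortion is used
  again and again to exclude a drift under iteration. The additive displacement finally serves as a
  potential: it vanishes on stabilizers of points, so it induces a height on \<open>S\<close>, and
  this height turns out to be linear.\<close>

lemma int_bounded_below_has_min:
  fixes a :: "nat \<Rightarrow> int"
  assumes "\<And>m. b \<le> a m"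
  obtains m where "\<And>n. a m \<le> a n"
proof -
  obtain m where "\<And>n. nat (a m - b) \<le> nat (a n - b)"
    using ex_has_least_nat[of "\<lambda>_. True" 0 "\<lambda>m. nat (a m - b)"] by auto
  with assms have "a m \<le> a n" for n
    by (smt (verit) nat_le_eq_zle)
  then show thesis using that by blast
qed

text \<open>The sequence \<open>a x m\<close> is non-increasing in \<open>m\<close> and bounded
  below by \<open>f x - C\<close>, so it becomes constant. Replacing \<open>x\<close> by
  \<open>x + k\<close> only shifts this sequence, up to a constant, so the finitely many residues
  \<open>0..<k\<close> suffice for a common threshold.\<close>

lemma eventually_translates:
  fixes f :: "int \<Rightarrow> int"
  assumes k: "k \<ge> 1" and le: "\<And>x. f (x + k) \<le> f x + k"
    and C: "\<And>x y. \<bar>f y - f x - (y - x)\<bar> \<le> C"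
  obtains X where "\<And>x. x \<ge> X \<Longrightarrow> f (x + k) = f x + k"
proof -
  define a where "a x m = f (x + int m * k) - int m * k" for x m
  have dec: "a x (Suc m) \<le> a x m" for x m
    using le[of "x + int m * k"] by (simp add: a_def algebra_simps)
  have "\<exists>m. \<forall>n. a x m \<le> a x n" for x
  proof -
    have "f x - C \<le> a x m" for m
      using C[where x=x and y="x + int m * k"] by (simp add: a_def)
    from int_bounded_below_has_min[OF this] show ?thesis by metis
  qed
  then obtain m0 where m0: "\<And>x n. a x (m0 x) \<le> a x n" by metis
  define M where "M = Max (m0 ` {0..<k})"
  have "f (x + k) = f x + k" if "x \<ge> int M * k" for x
  proof -
    define y where "y = x mod k"
    define m where "m = nat (x div k)"
    have "int M \<le> x div k" using that k zdiv_mono1[of "int M * k" x k] by simp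
    then have m: "M \<le> m" "x = y + int m * k"
      unfolding m_def y_def by auto
    have "y \<in> {0..<k}" using k by (simp add: y_def)
    then have "m0 y \<le> M" unfolding M_def by (intro Max_ge) auto
    with m have "m0 y \<le> m" by simp
    have anti: "a y n \<le> a y (m0 y)" if "n \<ge> m0 y" for n
      using that by (induction n rule: dec_induct) (auto intro: order_trans dec)
    have "a y m = a y (m0 y)" "a y (Suc m) = a y (m0 y)"
      using anti[of m] anti[of "Suc m"] m0[of y] \<open>m0 y \<le> m\<close> by (auto intro: antisym)
    then have "a y (Suc m) = a y m" by simp
    then show ?thesis unfolding a_def m(2) by (simp add: algebra_simps)
  qed
  then show thesis using that by blast
qed

text \<open>The recurring way to exclude a drift: \<open>m\<close> repetitions of a move by
  \<open>a\<close> stay within a bound independent of \<open>m\<close>.\<close>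

lemma linear_bounded_imp_zero:
  fixes a b :: int assumes "\<And>m::nat. \<bar>int m * a\<bar> \<le> b" shows "a = 0"
proof (rule ccontr)
  assume "a \<noteq> 0"
  then have "\<bar>a\<bar> \<ge> 1" by simp
  then have "int (nat \<bar>b\<bar> + 1) * 1 \<le> int (nat \<bar>b\<bar> + 1) * \<bar>a\<bar>" by (intro mult_left_mono) auto
  with assms[of "nat \<bar>b\<bar> + 1"] show False by (simp add: abs_mult)
qed

text \<open>The limit axiom speaks of differences because \<open>E\<close> contains all
  translations, so the values themselves may escape to infinity.\<close>

locale compact_monoid =
  fixes E :: "(int \<Rightarrow> int) set"
  assumes translation: "(\<lambda>x. x + c) \<in> E"
    and comp: "f \<in> E \<Longrightarrow> g \<in> E \<Longrightarrow> f \<circ> g \<in> E"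
    and limit: "(\<And>n::nat. F n \<in> E) \<Longrightarrow>
      \<exists>f\<in>E. \<exists>r. strict_mono r \<and> (\<forall>u v. \<forall>\<^sub>F n in sequentially. F (r n) u - F (r n) v = f u - f v)"
begin

lemma shift_mem: assumes "f \<in> E" shows "(\<lambda>x. f (x + a) + b) \<in> E"
  using comp[OF translation[of b] comp[OF assms translation[of a]]] by (simp add: o_def)

text \<open>Compactness bounds the steps \<open>f 1 - f 0\<close>, so a largest absolute value
  \<open>k\<close> is attained, say by \<open>f\<close>. Composing any \<open>g\<close> with a
  translate of \<open>f\<close> gives a member of \<open>E\<close>, so \<open>g\<close> cannot
  stretch a pair at distance \<open>k\<close> beyond \<open>k\<close>.\<close>

lemma max_step:
  obtains k where "k \<ge> 1" "\<And>f x. f \<in> E \<Longrightarrow> \<bar>f (x + 1) - f x\<bar> \<le> k"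
    "\<And>f x. f \<in> E \<Longrightarrow> \<bar>f (x + k) - f x\<bar> \<le> k"
proof -
  have "\<exists>B. \<forall>f\<in>E. \<bar>f 1 - f 0\<bar> \<le> B"
  proof (rule ccontr)
    assume "\<not> ?thesis"
    then have "\<forall>n. \<exists>f\<in>E. \<bar>f 1 - f 0\<bar> > int n" by (meson not_le)
    then obtain F where F: "\<And>n. F n \<in> E" "\<And>n. \<bar>F n 1 - F n 0\<bar> > int n" by metis
    from limit[of F, OF F(1)] obtain f and r :: "nat \<Rightarrow> nat" where r: "strict_mono r"
      "\<And>u v. \<forall>\<^sub>F n in sequentially. F (r n) u - F (r n) v = f u - f v" by blast
    from r(2)[of 1 0] eventually_ge_at_top[of "nat \<bar>f 1 - f 0\<bar>"]
    have "\<forall>\<^sub>F n in sequentially. False"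
    proof eventually_elim
      case (elim n)
      have "n \<le> r n" using r(1) by (rule strict_mono_imp_increasing)
      with F(2)[of "r n"] elim show False by linarith
    qed
    then show False by simp
  qed
  then obtain B where B: "\<And>f. f \<in> E \<Longrightarrow> \<bar>f 1 - f 0\<bar> \<le> B" by blast
  define A where "A = (\<lambda>f. \<bar>f 1 - f 0\<bar>) ` E"
  define k where "k = Max A"
  have id: "(\<lambda>x. x) \<in> E" using translation[of 0] by simp
  have "A \<subseteq> {0..B}" using B by (auto simp: A_def)
  then have fin: "finite A" by (rule finite_subset) simp
  have "A \<noteq> {}" using id by (auto simp: A_def)
  then have "k \<in> A" unfolding k_def using fin by simp
  then obtain f where f: "f \<in> E" "\<bar>f 1 - f 0\<bar> = k" by (auto simp: A_def)
  have k: "\<bar>g 1 - g 0\<bar> \<le> k" if "g \<in> E" for g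
    unfolding k_def using fin that by (auto simp: A_def)
  have "k \<ge> 1" using k[OF id] by simp
  moreover have "\<bar>g (x + 1) - g x\<bar> \<le> k" if "g \<in> E" for g x
    using k[OF shift_mem[OF that, of x 0]] by (simp add: add.commute)
  moreover have "\<bar>g (x + k) - g x\<bar> \<le> k" if "g \<in> E" for g x
  proof -
    \<comment> \<open>The translation moves the points \<open>f 0\<close> and \<open>f 1\<close>
      onto \<open>x\<close> and \<open>x + k\<close>, in one order or the other.\<close>
    have "g \<circ> (\<lambda>y. f y + (x - min (f 0) (f 1))) \<in> E"
      using comp[OF that shift_mem[OF f(1), of 0 "x - min (f 0) (f 1)"]] by simp
    from k[OF this] show ?thesis using f(2)
      by (cases "f 0 \<le> f 1") (auto simp: algebra_simps abs_minus_commute split: if_splits)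
  qed
  ultimately show thesis using that by blast
qed

end

section \<open>Maps of infinite range preserve distances up to a constant\<close>

locale unbounded_compact_monoid = compact_monoid +
  fixes k :: int
  assumes k: "k \<ge> 1"
    and step1: "f \<in> E \<Longrightarrow> \<bar>f (x + 1) - f x\<bar> \<le> k"
    and stepk: "f \<in> E \<Longrightarrow> \<bar>f (x + k) - f x\<bar> \<le> k"
    and infinite_range: "f \<in> E \<Longrightarrow> infinite (range f)"
begin

text \<open>Cut the distance into \<open>l div k\<close> steps of length \<open>k\<close> and fewer
  than \<open>k\<close> unit steps, each stretched to at most \<open>k\<close>; the unit steps cause
  the error \<open>k * k\<close>.\<close>

lemma expansion:
  assumes "f \<in> E" "l \<ge> 0" shows "\<bar>f (x + l) - f x\<bar> \<le> l + k * k"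
proof -
  have 1: "\<bar>f (x + int m) - f x\<bar> \<le> int m * k" for x m
  proof (induction m)
    case (Suc m)
    with step1[OF assms(1), of "x + int m"] show ?case by (simp add: algebra_simps)
  qed simp
  have 2: "\<bar>f (x + int m * k) - f x\<bar> \<le> int m * k" for x m
  proof (induction m)
    case (Suc m)
    with stepk[OF assms(1), of "x + int m * k"] show ?case by (simp add: algebra_simps)
  qed simp
  have l: "l = int (nat (l div k)) * k + int (nat (l mod k))"
    using assms(2) k by (simp add: pos_imp_zdiv_nonneg_iff)
  have "int (nat (l mod k)) \<le> k" using k by (simp add: order.strict_implies_order)
  then have "int (nat (l mod k)) * k \<le> k * k" using k by (intro mult_right_mono) auto
  with 2[of x "nat (l div k)"] 1[of "x + int (nat (l div k)) * k" "nat (l mod k)"]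
  show ?thesis using l k by (smt (verit, best) add.assoc of_nat_0_le_iff)
qed

lemma expansion': "f \<in> E \<Longrightarrow> \<bar>f x - f y\<bar> \<le> \<bar>x - y\<bar> + k * k"
  using expansion[of f "x - y" y] expansion[of f "y - x" x] by (cases "y \<le> x") auto

text \<open>If compression were possible at all lengths from \<open>n\<close> on, it could be
  repeated: an image of \<open>{-L..L}\<close> inside an interval of length \<open>w > m\<close> can
  be mapped into a shorter one. So every \<open>{-L..L}\<close> has an image of diameter at most
  \<open>m\<close>, and a limit for growing \<open>L\<close> has finite range.\<close>

lemma incompressible_interval:
  "\<exists>v\<ge>n. \<forall>f\<in>E. \<exists>x\<in>{0..v}. \<exists>y\<in>{0..v}. \<bar>f x - f y\<bar> \<ge> v"
proof (rule ccontr)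
  assume contr: "\<not> ?thesis"
  have compressible: "\<exists>f\<in>E. \<forall>x\<in>{0..v}. \<forall>y\<in>{0..v}. \<bar>f x - f y\<bar> < v" if "v \<ge> n" for v
    using contr that by (meson not_le)
  define m where "m = max n 0"
  have "\<exists>f\<in>E. \<forall>x\<in>{-int L..int L}. \<forall>y\<in>{-int L..int L}. \<bar>f x - f y\<bar> \<le> m" for L
  proof -
    let ?I = "{-int L..int L}"
    let ?P = "\<lambda>w. \<exists>f\<in>E. \<exists>a. f ` ?I \<subseteq> {a..a + int w}"
    have "?P (2 * L)"
      using translation[of 0] by (intro bexI[of _ "\<lambda>x. x"] exI[of _ "-int L"]) auto
    then have "?P (LEAST w. ?P w)" by (rule LeastI)
    then obtain w f a where w: "w = (LEAST w. ?P w)" and f: "f \<in> E" "f ` ?I \<subseteq> {a..a + int w}" by blast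
    have "int w \<le> m"
    proof (rule ccontr)
      assume "\<not> int w \<le> m"
      then have "int w \<ge> n" "w \<ge> 1" by (auto simp: m_def)
      from compressible[OF this(1)] obtain g where g: "g \<in> E"
        "\<forall>x\<in>{0..int w}. \<forall>y\<in>{0..int w}. \<bar>g x - g y\<bar> < int w" by blast
      let ?h = "g \<circ> (\<lambda>x. f x - a)"
      have h: "?h \<in> E" using comp[OF g(1) shift_mem[OF f(1), of 0 "-a"]] by simp
      have in0: "f x - a \<in> {0..int w}" if "x \<in> ?I" for x using f(2) that by (force simp: image_subset_iff)
      define b where "b = Min (?h ` ?I)"
      have "b \<in> ?h ` ?I" unfolding b_def by (intro Min_in) auto
      then obtain y where y: "y \<in> ?I" "b = ?h y" by blast
      have "?h x \<in> {b..b + int (w - 1)}" if "x \<in> ?I" for x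
      proof -
        have "b \<le> ?h x" unfolding b_def using that by (intro Min_le) auto
        moreover have "\<bar>?h x - ?h y\<bar> < int w" using g(2) in0 that y(1) by auto
        ultimately show ?thesis using y(2) \<open>w \<ge> 1\<close> by auto
      qed
      then have "?P (w - 1)" using h by blast
      then have "w \<le> w - 1" unfolding w by (rule Least_le)
      then show False using \<open>w \<ge> 1\<close> by simp
    qed
    moreover have "\<bar>f x - f y\<bar> \<le> int w" if "x \<in> ?I" "y \<in> ?I" for x y
    proof -
      have "f x \<in> {a..a + int w}" "f y \<in> {a..a + int w}" using f(2) that by (auto simp: image_subset_iff)
      then show ?thesis by auto
    qed
    ultimately show ?thesis using f(1) by (meson order_trans)
  qed
  then obtain F where F: "\<And>L. F L \<in> E"
    "\<And>L x y. x \<in> {-int L..int L} \<Longrightarrow> y \<in> {-int L..int L} \<Longrightarrow> \<bar>F L x - F L y\<bar> \<le> m" by metis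
  from limit[of F, OF F(1)] obtain f and r :: "nat \<Rightarrow> nat" where r: "f \<in> E" "strict_mono r"
    "\<And>u v. \<forall>\<^sub>F n in sequentially. F (r n) u - F (r n) v = f u - f v" by blast
  have "\<bar>f x - f 0\<bar> \<le> m" for x
  proof -
    from r(3)[of x 0] eventually_ge_at_top[of "nat \<bar>x\<bar>"]
    have "\<forall>\<^sub>F n in sequentially. \<bar>f x - f 0\<bar> \<le> m"
    proof eventually_elim
      case (elim n)
      have "n \<le> r n" using r(2) by (rule strict_mono_imp_increasing)
      with elim(2) have "x \<in> {-int (r n)..int (r n)}" by auto
      with F(2)[of x "r n" 0] elim(1) show ?case by auto
    qed
    then show ?thesis by simp
  qed
  then have "range f \<subseteq> {f 0 - m..f 0 + m}" by (auto simp: abs_le_iff algebra_simps)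
  then have "finite (range f)" by (rule finite_subset) simp
  with infinite_range[OF r(1)] show False ..
qed

text \<open>Place the segment at the start of an incompressible interval \<open>{0..v}\<close>. A
  pair whose images are \<open>v\<close> apart satisfies \<open>z - y >= v - k * k\<close> by
  \<open>expansion'\<close>, so it nearly spans the interval. The pieces between this pair and the
  ends of the segment stretch little, which leaves enough length for the segment.\<close>

lemma contraction:
  assumes "f \<in> E" shows "\<bar>f x - f y\<bar> \<ge> \<bar>x - y\<bar> - 4 * (k * k)"
proof -
  have main: "\<bar>f (x + l) - f x\<bar> \<ge> l - 4 * (k * k)" if "l \<ge> 0" for x l
  proof -
    obtain v where v: "v \<ge> l" "\<And>f. f \<in> E \<Longrightarrow> \<exists>x\<in>{0..v}. \<exists>y\<in>{0..v}. \<bar>f x - f y\<bar> \<ge> v"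
      using incompressible_interval[of l] by blast
    define g where "g = (\<lambda>y. f (y + x))"
    have g: "g \<in> E" using shift_mem[OF assms, of x 0] by (simp add: g_def)
    have "\<exists>y\<in>{0..v}. \<exists>z\<in>{0..v}. y \<le> z \<and> \<bar>g z - g y\<bar> \<ge> v"
      using v(2)[OF g] by (metis abs_minus_commute linear)
    then obtain y z where yz: "0 \<le> y" "y \<le> z" "z \<le> v" "\<bar>g z - g y\<bar> \<ge> v" by auto
    have "\<bar>g z - g y\<bar> \<le> z - y + k * k" "\<bar>g y - g 0\<bar> \<le> y + k * k" "\<bar>g l - g z\<bar> \<le> \<bar>l - z\<bar> + k * k"
      using expansion'[OF g, of z y] expansion'[OF g, of y 0] expansion'[OF g, of l z] yz by auto
    then have "\<bar>g l - g 0\<bar> \<ge> l - 4 * (k * k)" using yz v(1) that by linarith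
    then show ?thesis by (simp add: g_def add.commute)
  qed
  show ?thesis using main[of "x - y" y] main[of "y - x" x]
    by (cases "y \<le> x") (auto simp: abs_minus_commute)
qed

text \<open>The value comes from \<open>orientation\<close>: it bounds
  \<open>2 * L + 4 * (k * k)\<close> for \<open>L = 4 * (k * k) + k + 1\<close>, as
  \<open>k >= 1\<close>.\<close>

definition "distortion = 16 * (k * k)"

text \<open>Points at distance at least \<open>L\<close> have images more than \<open>k\<close>
  apart by \<open>contraction\<close>, whereas moving an endpoint by one changes the difference of
  the images by at most \<open>k\<close>. So its sign is the same for all such pairs, and
  \<open>expansion\<close> and \<open>contraction\<close> fix its size; shorter distances are
  absorbed by the constant.\<close>

lemma orientation:
  assumes f: "f \<in> E"
  shows "(\<forall>x y. \<bar>f y - f x - (y - x)\<bar> \<le> distortion) \<or> (\<forall>x y. \<bar>f y - f x + (y - x)\<bar> \<le> distortion)"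
proof -
  define L where "L = 4 * (k * k) + k + 1"
  have kk: "k * k \<ge> k" using k by simp
  have step: "\<bar>f (y + 1) - f y\<bar> \<le> k" for y using step1[OF f] .
  have low: "l \<ge> L \<Longrightarrow> \<bar>f (x + l) - f x\<bar> > k" for x l
    using contraction[OF f, of "x + l" x] unfolding L_def by auto
  have sgn1: "f (x + l) - f x > 0 \<longleftrightarrow> f (x + L) - f x > 0" if "l \<ge> L" for x l
    using that
  proof (induction l rule: int_ge_induct)
    case (step l)
    then show ?case using low[of l x] low[of "l + 1" x] step1[OF f, of "x + l"] k
      by (smt (verit, ccfv_threshold) add.assoc)
  qed simp
  have sgnx: "f (x + 1 + L) - f (x + 1) > 0 \<longleftrightarrow> f (x + L) - f x > 0" for x
    using sgn1[of "L + 1" x] low[of "L + 1" x] low[of L "x + 1"] step[of x] k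
    by (smt (verit, best) add.assoc add.commute)
  have sgn2: "f (x + L) - f x > 0 \<longleftrightarrow> f (0 + L) - f 0 > 0" for x
  proof (induction x rule: int_induct[where k=0])
    case (step2 i)
    then show ?case using sgnx[of "i - 1"] by simp
  qed (use sgnx in auto)
  have up: "\<bar>f (x + l) - f x\<bar> \<le> l + k * k" if "l \<ge> 0" for x l
    using expansion[OF f that] .
  have distortion: "2 * L + 4 * (k * k) \<le> 16 * (k * k)"
  proof -
    have "2 * (4 * q + k + 1) + 4 * q \<le> 16 * q" if "k \<le> q" for q using that k by (simp add: algebra_simps)
    from this[OF kk] show ?thesis unfolding L_def .
  qed
  show ?thesis
  proof (cases "f (0 + L) - f 0 > 0")
    case True
    have "\<bar>f (x + l) - f x - l\<bar> \<le> distortion" if "l \<ge> 0" for x l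
    proof (cases "l \<ge> L")
      case True': True
      then have "f (x + l) - f x > 0" using sgn1 sgn2 True by blast
      then show ?thesis using up[OF that, of x] contraction[OF f, of "x + l" x] kk that k
        unfolding distortion_def by (smt (verit, ccfv_threshold))
    next
      case False
      then show ?thesis using up[OF that, of x] distortion that kk k unfolding distortion_def by linarith
    qed
    then have "\<bar>f y - f x - (y - x)\<bar> \<le> distortion" if "x \<le> y" for x y using that
      by (metis add.commute diff_add_cancel diff_ge_0_iff_ge)
    then have "\<bar>f y - f x - (y - x)\<bar> \<le> distortion" for x y
      by (smt (verit, best))
    then show ?thesis by blast
  next
    case False
    have "\<bar>f (x + l) - f x + l\<bar> \<le> distortion" if "l \<ge> 0" for x l
    proof (cases "l \<ge> L")
      case True
      then have "f (x + l) - f x < 0" using sgn1[of l x] sgn2[of x] False low[of l x] k by linarith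
      then show ?thesis using up[OF that, of x] contraction[OF f, of "x + l" x] kk that k
        unfolding distortion_def by (smt (verit, ccfv_threshold))
    next
      case False
      then show ?thesis using up[OF that, of x] distortion that kk k unfolding distortion_def by linarith
    qed
    then have "\<bar>f y - f x + (y - x)\<bar> \<le> distortion" if "x \<le> y" for x y using that
      by (metis add.commute diff_add_cancel diff_ge_0_iff_ge)
    then have "\<bar>f y - f x + (y - x)\<bar> \<le> distortion" for x y
      by (smt (verit, best))
    then show ?thesis by blast
  qed
qed


section \<open>Orientation, and periodic limits at both ends of the line\<close>

definition forward :: "(int \<Rightarrow> int) set" where
  "forward = {f \<in> E. \<exists>B. \<forall>x y. \<bar>f y - f x - (y - x)\<bar> \<le> B}"

definition backward :: "(int \<Rightarrow> int) set" where
  "backward = {f \<in> E. \<exists>B. \<forall>x y. \<bar>f y - f x + (y - x)\<bar> \<le> B}"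

lemma forward_or_backward: "f \<in> E \<Longrightarrow> f \<in> forward \<or> f \<in> backward"
  using orientation[of f] unfolding forward_def backward_def by blast

lemma forwardI: "f \<in> E \<Longrightarrow> (\<And>x y. \<bar>f y - f x - (y - x)\<bar> \<le> B) \<Longrightarrow> f \<in> forward"
  unfolding forward_def by blast

lemma forwardD: "f \<in> forward \<Longrightarrow> f \<in> E"
  unfolding forward_def by blast

text \<open>No map stays close to both slopes 1 and -1, which excludes the second alternative of
  \<open>orientation\<close>. Thus an unspecified bound, as obtained for composites, improves to a
  uniform one; this is what makes arguments on powers possible.\<close>

lemma forward_bound:
  assumes "f \<in> forward" shows "\<bar>f y - f x - (y - x)\<bar> \<le> distortion"
proof -
  from assms obtain B where f: "f \<in> E" "\<And>x y. \<bar>f y - f x - (y - x)\<bar> \<le> B"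
    unfolding forward_def by blast
  have False if "\<forall>x y. \<bar>f y - f x + (y - x)\<bar> \<le> distortion"
  proof -
    have "\<bar>int m * 2\<bar> \<le> B + distortion" for m
      using f(2)[where x=0 and y="int m"] that[rule_format, where x=0 and y="int m"] by linarith
    from linear_bounded_imp_zero[OF this] show False by simp
  qed
  with orientation[OF f(1)] show ?thesis by blast
qed

lemma forward_comp: assumes "f \<in> forward" "g \<in> forward" shows "f \<circ> g \<in> forward"
proof (rule forwardI)
  show "f \<circ> g \<in> E" using assms comp forwardD by blast
  show "\<bar>(f \<circ> g) y - (f \<circ> g) x - (y - x)\<bar> \<le> distortion + distortion" for x y
    using forward_bound[OF assms(1), of "g y" "g x"] forward_bound[OF assms(2), of y x] by simp
qed

lemma forward_shift: assumes "f \<in> forward" shows "(\<lambda>x. f (x + a) + b) \<in> forward"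
proof (rule forwardI)
  show "(\<lambda>x. f (x + a) + b) \<in> E" using assms shift_mem forwardD by blast
  show "\<bar>f (y + a) + b - (f (x + a) + b) - (y - x)\<bar> \<le> distortion" for x y
    using forward_bound[OF assms, of "y + a" "x + a"] by simp
qed

lemma forward_translation: "(\<lambda>x. x + c) \<in> forward"
  by (rule forwardI[where B=0]) (auto intro: translation)

lemma forward_funpow: "f \<in> forward \<Longrightarrow> f ^^ n \<in> forward"
  by (induction n) (use forward_translation[of 0] in \<open>auto simp: id_def intro: forward_comp\<close>)

lemma forward_stepk: "f \<in> forward \<Longrightarrow> f (x + k) \<le> f x + k"
  using stepk[OF forwardD, of f x] by simp

lemma forward_stepk_nat: "f \<in> forward \<Longrightarrow> f (x + int m * k) \<le> f x + int m * k"
proof (induction m)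
  case (Suc m)
  with forward_stepk[of f "x + int m * k"] show ?case by (simp add: algebra_simps)
qed simp

definition periodic :: "(int \<Rightarrow> int) set" where
  "periodic = {f \<in> forward. \<forall>x. f (x + k) = f x + k}"

lemma periodicD: assumes "f \<in> periodic" shows "f \<in> forward" "f (x + k) = f x + k"
  using assms unfolding periodic_def by auto

lemma periodic_comp: "f \<in> periodic \<Longrightarrow> g \<in> periodic \<Longrightarrow> f \<circ> g \<in> periodic"
  unfolding periodic_def using forward_comp by auto

lemma periodic_translation: "(\<lambda>x. x + c) \<in> periodic"
  unfolding periodic_def using forward_translation by auto

lemma periodic_shift: assumes "f \<in> periodic" shows "(\<lambda>x. f (x + a) + b) \<in> periodic"
  using periodic_comp[OF periodic_translation[of b] periodic_comp[OF assms periodic_translation[of a]]]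
  by (simp add: o_def)

lemma periodic_funpow: "f \<in> periodic \<Longrightarrow> f ^^ n \<in> periodic"
  by (induction n) (use periodic_translation[of 0] in \<open>auto simp: id_def intro: periodic_comp\<close>)

lemma add_multiple_if_add_k:
  fixes f :: "int \<Rightarrow> int"
  assumes "\<And>x. x \<in> S \<Longrightarrow> f (x + k) = f x + k" and S: "\<And>x. x + k \<in> S \<longleftrightarrow> x \<in> S" and "x \<in> S"
  shows "f (x + j * k) = f x + j * k \<and> x + j * k \<in> S"
proof (induction j rule: int_induct[where k=0])
  case base
  then show ?case using assms(3) by simp
next
  case (step1 i)
  then show ?case using assms(1)[of "x + i * k"] S[of "x + i * k"] by (simp add: algebra_simps)
next
  case (step2 i)
  have e: "x + (i - 1) * k + k = x + i * k" by (simp add: algebra_simps)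
  with S[of "x + (i - 1) * k"] step2 have "x + (i - 1) * k \<in> S" by simp
  with assms(1)[OF this] e step2 show ?case by (simp add: algebra_simps)
qed

lemma periodic_multiple: "f \<in> periodic \<Longrightarrow> f (x + j * k) = f x + j * k"
  using add_multiple_if_add_k[of UNIV f x j] periodicD(2) by auto

text \<open>The value \<open>\<beta> x\<close> is the one that
  \<open>f (x + m * \<sigma>) - m * \<sigma>\<close> takes once the argument of \<open>f\<close> has
  entered \<open>U\<close>. Conjugates of \<open>f\<close> by translations lie in \<open>E\<close>,
  and so does their limit. The sign of \<open>\<sigma>\<close> selects the end of the line.\<close>

lemma periodic_limit:
  assumes f: "f \<in> forward" and \<sigma>: "\<sigma> = k \<or> \<sigma> = - k"
    and U: "\<And>x. x \<in> U \<Longrightarrow> x + \<sigma> \<in> U" "\<And>x. \<exists>m::nat. x + int m * \<sigma> \<in> U"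
    and eq: "\<And>x. x \<in> U \<Longrightarrow> f (x + \<sigma>) = f x + \<sigma>"
  obtains \<beta> where "\<beta> \<in> periodic" "\<And>x. x \<in> U \<Longrightarrow> \<beta> x = f x"
proof -
  define F where "F m x = f (x + int m * \<sigma>) - int m * \<sigma>" for m x
  have F: "F m \<in> forward" for m
    using forward_shift[OF f, of "int m * \<sigma>" "- (int m * \<sigma>)"] by (simp add: F_def[abs_def])
  obtain M where M: "\<And>x. x + int (M x) * \<sigma> \<in> U" using U(2) by metis
  define \<beta> where "\<beta> x = F (M x) x" for x
  have inU: "x + int m * \<sigma> \<in> U" if "m \<ge> M x" for x m
    using that
  proof (induction m rule: dec_induct)
    case (step n)
    then show ?case using U(1)[of "x + int n * \<sigma>"] by (simp add: algebra_simps)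
  qed (rule M)
  have \<beta>: "F m x = \<beta> x" if "m \<ge> M x" for m x
    using that
  proof (induction m rule: dec_induct)
    case (step n)
    have "F (Suc n) x = F n x"
      using eq[OF inU[OF step(1)]] by (simp add: F_def algebra_simps)
    with step show ?case by simp
  qed (simp add: \<beta>_def)
  have "\<beta> \<in> E"
  proof -
    have "\<And>n. F n \<in> E" using F forwardD by blast
    from limit[of F, OF this] obtain g and r :: "nat \<Rightarrow> nat" where r: "g \<in> E" "strict_mono r"
      "\<And>u v. \<forall>\<^sub>F n in sequentially. F (r n) u - F (r n) v = g u - g v" by blast
    have "\<beta> u - \<beta> v = g u - g v" for u v
    proof -
      from r(3)[of u v] eventually_ge_at_top[of "M u"] eventually_ge_at_top[of "M v"]
      have "\<forall>\<^sub>F n in sequentially. \<beta> u - \<beta> v = g u - g v"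
      proof eventually_elim
        case (elim n)
        have "n \<le> r n" using r(2) by (rule strict_mono_imp_increasing)
        with elim \<beta>[of u "r n"] \<beta>[of v "r n"] show ?case by simp
      qed
      then show ?thesis by simp
    qed
    \<comment> \<open>The limit axiom yields \<open>\<beta>\<close> only up to an additive
      constant.\<close>
    from this[of _ 0] have "\<beta> = (\<lambda>x. g (x + 0) + (\<beta> 0 - g 0))" by (auto simp: algebra_simps)
    then show ?thesis using shift_mem[OF r(1)] by metis
  qed
  moreover have "\<bar>\<beta> y - \<beta> x - (y - x)\<bar> \<le> distortion" for x y
    using forward_bound[OF F, of "max (M x) (M y)" y x] \<beta>[of x "max (M x) (M y)"] \<beta>[of y "max (M x) (M y)"]
    by simp
  ultimately have "\<beta> \<in> forward" by (rule forwardI)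
  moreover have \<beta>\<sigma>: "\<beta> (x + \<sigma>) = \<beta> x + \<sigma>" for x
  proof -
    let ?m = "max (M x) (M (x + \<sigma>))"
    have "\<beta> (x + \<sigma>) = F ?m (x + \<sigma>)" "\<beta> x = F (Suc ?m) x" using \<beta> by simp_all
    then show ?thesis by (simp add: F_def algebra_simps)
  qed
  have "\<beta> (x + k) = \<beta> x + k" for x
    using \<sigma> \<beta>\<sigma>[of x] \<beta>\<sigma>[of "x + k"] by (elim disjE) simp_all
  moreover have "\<beta> x = f x" if "x \<in> U" for x
  proof -
    have "x + int m * \<sigma> \<in> U \<and> f (x + int m * \<sigma>) = f x + int m * \<sigma>" for m
    proof (induction m)
      case (Suc m)
      then show ?case using U(1)[of "x + int m * \<sigma>"] eq[of "x + int m * \<sigma>"] by (simp add: algebra_simps)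
    qed (simp add: that)
    then show ?thesis by (simp add: \<beta>_def F_def)
  qed
  ultimately show thesis using that unfolding periodic_def by blast
qed

lemma limit_right:
  assumes f: "f \<in> forward"
  obtains \<beta> X where "\<beta> \<in> periodic" "\<And>x. x \<ge> X \<Longrightarrow> \<beta> x = f x"
proof -
  obtain X where X: "\<And>x. x \<ge> X \<Longrightarrow> f (x + k) = f x + k"
    using eventually_translates[OF k forward_stepk[OF f] forward_bound[OF f]] by blast
  have "\<exists>m::nat. x + int m * k \<in> {X..}" for x
  proof
    have "int (nat \<bar>X - x\<bar>) * 1 \<le> int (nat \<bar>X - x\<bar>) * k" using k by (intro mult_left_mono) auto
    then show "x + int (nat \<bar>X - x\<bar>) * k \<in> {X..}" by simp
  qed
  then obtain \<beta> where "\<beta> \<in> periodic" "\<And>x. x \<in> {X..} \<Longrightarrow> \<beta> x = f x"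
    using periodic_limit[OF f, of k "{X..}"] X k by auto
  then show thesis using that by auto
qed

lemma limit_left:
  assumes f: "f \<in> forward"
  obtains \<beta> X where "\<beta> \<in> periodic" "\<And>x. x \<le> X \<Longrightarrow> \<beta> x = f x"
proof -
  \<comment> \<open>Reflection turns the left end into the right one. The map \<open>?g\<close> need
    not lie in \<open>E\<close>, but \<open>eventually_translates\<close> asks only for
    inequalities.\<close>
  let ?g = "\<lambda>x. - f (- x)"
  have "?g (x + k) \<le> ?g x + k" for x using forward_stepk[OF f, of "- x - k"] by simp
  moreover have "\<bar>?g y - ?g x - (y - x)\<bar> \<le> distortion" for x y using forward_bound[OF f, of "-x" "-y"] by simp
  ultimately obtain X where X: "\<And>x. x \<ge> X \<Longrightarrow> ?g (x + k) = ?g x + k"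
    using eventually_translates[OF k, of ?g] by blast
  have X': "f (x + - k) = f x + - k" if "x \<in> {..-X}" for x using X[of "-x"] that by simp
  have "\<exists>m::nat. x + int m * (- k) \<in> {..-X}" for x
  proof
    have "int (nat \<bar>X + x\<bar>) * 1 \<le> int (nat \<bar>X + x\<bar>) * k" using k by (intro mult_left_mono) auto
    then show "x + int (nat \<bar>X + x\<bar>) * (- k) \<in> {..-X}" by simp
  qed
  then obtain \<beta> where "\<beta> \<in> periodic" "\<And>x. x \<in> {..-X} \<Longrightarrow> \<beta> x = f x"
    using periodic_limit[OF f, of "- k" "{..-X}"] X' k by auto
  then show thesis using that by auto
qed

end

section \<open>Retraction onto as few residue classes as possible\<close>

context unbounded_compact_monoid
begin

definition classes :: "(int \<Rightarrow> int) \<Rightarrow> nat" where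
  "classes f = card (range (\<lambda>x. f x mod k))"

lemma finite_residues: "finite (range (\<lambda>x. f x mod k))" for f :: "int \<Rightarrow> int"
  by (rule finite_subset[of _ "{0..<k}"]) (use k in auto)

text \<open>The iterates of \<open>f\<close> modulo \<open>k\<close> repeat by the pigeonhole principle; injectivity
  lets us cancel, and bounded distortion makes the drift the same on all classes.\<close>

lemma power_is_translation:
  assumes f: "f \<in> periodic" and S: "\<And>x. x + k \<in> S \<longleftrightarrow> x \<in> S" and fS: "f ` S \<subseteq> S"
    and inj: "\<And>x y. x \<in> S \<Longrightarrow> y \<in> S \<Longrightarrow> f x mod k = f y mod k \<Longrightarrow> x mod k = y mod k"
  obtains N c where "N \<ge> 1" "\<And>x. x \<in> S \<Longrightarrow> (f ^^ N) x = x + c * k"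
proof -
  have pS: "(f ^^ n) x \<in> S" if "x \<in> S" for n x
    using that fS by (induction n) auto
  have pinj: "x mod k = y mod k" if "(f ^^ n) x mod k = (f ^^ n) y mod k" "x \<in> S" "y \<in> S" for n x y
    using that
  proof (induction n)
    case (Suc n)
    then show ?case using inj[OF pS pS, of x y n n] by simp
  qed simp
  define \<phi> where "\<phi> n = restrict (\<lambda>x. (f ^^ n) x mod k) {0..<k}" for n
  have "range \<phi> \<subseteq> {0..<k} \<rightarrow>\<^sub>E {0..<k}" using k by (auto simp: \<phi>_def)
  then have "finite (range \<phi>)" by (rule finite_subset) (auto intro: finite_PiE)
  then have "\<not> inj \<phi>" using finite_imageD infinite_UNIV_nat by blast
  then obtain i j where ij: "i < j" "\<phi> i = \<phi> j" by (metis injI linorder_neqE_nat)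
  define N where "N = j - i"
  have modf: "(f ^^ n) x mod k = (f ^^ n) (x mod k) mod k" for n x
  proof -
    have "(f ^^ n) (x mod k + (x div k) * k) = (f ^^ n) (x mod k) + (x div k) * k"
      using periodic_multiple[OF periodic_funpow[OF f]] .
    then show ?thesis by simp
  qed
  have "(f ^^ N) x mod k = x mod k" if "x \<in> S" for x
  proof -
    have "\<phi> i (x mod k) = \<phi> j (x mod k)" using ij by simp
    then have "(f ^^ i) x mod k = (f ^^ j) x mod k"
      unfolding modf[of _ x] using k by (simp add: \<phi>_def)
    also have "j = i + N" using ij by (simp add: N_def)
    finally show ?thesis
      using pinj[of i x "(f ^^ N) x"] pS[OF that] that by (simp add: funpow_add)
  qed
  then have "\<exists>c. (f ^^ N) x = x + c * k" if "x \<in> S" for x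
    using that by (metis add.commute diff_eq_eq dvd_div_mult_self mod_eq_dvd_iff)
  then obtain c where c: "\<And>x. x \<in> S \<Longrightarrow> (f ^^ N) x = x + c x * k" by metis
  have iter: "((f ^^ N) ^^ m) x = x + int m * c x * k" if "x \<in> S" for m x
  proof (induction m)
    case (Suc m)
    have "((f ^^ N) ^^ Suc m) x = (f ^^ N) (x + (int m * c x) * k)" using Suc by simp
    also have "\<dots> = (f ^^ N) x + int m * c x * k"
      using periodic_multiple[OF periodic_funpow[OF f]] .
    finally show ?case using c[OF that] by (simp add: algebra_simps)
  qed simp
  have const: "c x = c y" if "x \<in> S" "y \<in> S" for x y
  proof -
    have "\<bar>int m * (c y * k - c x * k)\<bar> \<le> distortion" for m
    proof -
      have "(f ^^ N) ^^ m \<in> forward" using forward_funpow periodicD(1)[OF f] by blast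
      from forward_bound[OF this, of y x] show ?thesis
        unfolding iter[OF that(1)] iter[OF that(2)] by (simp add: algebra_simps)
    qed
    from linear_bounded_imp_zero[OF this] k show ?thesis by simp
  qed
  have "N \<ge> 1" using ij by (simp add: N_def)
  moreover have "\<exists>c0. \<forall>x\<in>S. c x = c0" using const by metis
  ultimately show thesis using that c by (metis (no_types))
qed

text \<open>For a \<open>q\<close> with the fewest residues, \<open>f \<circ> q\<close> never has
  fewer, so every periodic \<open>f\<close> is injective on the residues of \<open>range q\<close>.
  For \<open>f = q\<close> this makes some power of \<open>q\<close> a translation by
  \<open>c * k\<close> on \<open>range q\<close>; undoing the translation gives
  \<open>p\<close>.\<close>

lemma periodic_retraction:
  obtains p where "p \<in> periodic" "\<And>x. p (p x) = p x"
    "\<And>f x y. f \<in> periodic \<Longrightarrow> x \<in> range p \<Longrightarrow> y \<in> range p \<Longrightarrow> f x mod k = f y mod k \<Longrightarrow> x mod k = y mod k"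
proof -
  have "\<exists>p. p \<in> periodic \<and> (\<forall>f. f \<in> periodic \<longrightarrow> classes p \<le> classes f)"
    by (rule ex_has_least_nat) (rule periodic_translation[of 0])
  then obtain q where q: "q \<in> periodic" "\<And>f. f \<in> periodic \<Longrightarrow> classes q \<le> classes f" by blast
  let ?S = "range q"
  have inj: "x mod k = y mod k"
    if f: "f \<in> periodic" and xy: "x \<in> ?S" "y \<in> ?S" "f x mod k = f y mod k" for f x y
  proof -
    let ?R = "range (\<lambda>x. q x mod k)"
    have fmod: "f x mod k = f (x mod k) mod k" for x
    proof -
      have "f (x mod k + (x div k) * k) = f (x mod k) + (x div k) * k"
        using periodic_multiple[OF f] .
      then show ?thesis by simp
    qed
    have "(\<lambda>r. f r mod k) ` ?R = range (\<lambda>x. (f \<circ> q) x mod k)"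
      using fmod by (auto simp: image_image)
    then have "card ?R \<le> card ((\<lambda>r. f r mod k) ` ?R)"
      using q(2)[OF periodic_comp[OF f q(1)]] by (simp add: classes_def)
    then have "inj_on (\<lambda>r. f r mod k) ?R"
      using card_image_le[OF finite_residues, of "\<lambda>r. f r mod k" q]
      by (intro eq_card_imp_inj_on finite_residues) simp
    moreover obtain a b where "x = q a" "y = q b" using xy(1,2) by blast
    ultimately show ?thesis using xy(3) fmod[of x] fmod[of y] inj_onD[of _ ?R "x mod k" "y mod k"] by simp
  qed
  have per: "x + k \<in> ?S \<longleftrightarrow> x \<in> ?S" for x
  proof
    assume "x + k \<in> ?S"
    then obtain y where "x + k = q y" by blast
    then have "x = q (y + (- 1) * k)" using periodic_multiple[OF q(1), of y "- 1"] by simp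
    then show "x \<in> ?S" by blast
  next
    assume "x \<in> ?S"
    then obtain y where "x = q y" by blast
    then have "x + k = q (y + k)" using periodicD(2)[OF q(1), of y] by simp
    then show "x + k \<in> ?S" by blast
  qed
  obtain N c where N: "N \<ge> 1" "\<And>x. x \<in> ?S \<Longrightarrow> (q ^^ N) x = x + c * k"
    using power_is_translation[OF q(1) per _ inj[OF q(1)]] by blast
  define p where "p x = (q ^^ N) x + - c * k" for x
  have p: "p \<in> periodic"
    using periodic_shift[OF periodic_funpow[OF q(1)], of N 0 "- c * k"] by (simp add: p_def[abs_def])
  have pS: "p x \<in> ?S" for x
  proof -
    have "(q ^^ N) x \<in> ?S" using N(1) by (cases N) auto
    then obtain y where "(q ^^ N) x = q y" by blast
    then have "p x = q (y + (- c) * k)" using periodic_multiple[OF q(1), of y "- c"] by (simp add: p_def)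
    then show ?thesis by blast
  qed
  have pid: "p x = x" if "x \<in> ?S" for x using N(2)[OF that] by (simp add: p_def)
  show thesis
    using that[OF p] pid[OF pS] inj pS by (metis rangeE)
qed

end

section \<open>Rigidity of the maps that preserve the range of the retraction\<close>

locale core = unbounded_compact_monoid +
  fixes p :: "int \<Rightarrow> int"
  assumes p: "p \<in> periodic" and idem: "p (p x) = p x"
    and minimal: "f \<in> periodic \<Longrightarrow> x \<in> range p \<Longrightarrow> y \<in> range p \<Longrightarrow> f x mod k = f y mod k \<Longrightarrow> x mod k = y mod k"
begin

definition "S = range p"

lemma pS [simp]: "p x \<in> S" by (simp add: S_def)
lemma p_id: "x \<in> S \<Longrightarrow> p x = x" using idem by (auto simp: S_def)

lemma S_multiple: "x + j * k \<in> S \<longleftrightarrow> x \<in> S"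
proof -
  have "x + j * k \<in> S" if "x \<in> S" for x j
    using p_id[OF that] periodic_multiple[OF p, of x j] by (metis pS)
  from this this[of "x + j * k" "- j"] show ?thesis by (auto simp: algebra_simps)
qed

lemma S_k: "x + k \<in> S \<longleftrightarrow> x \<in> S" using S_multiple[of x 1] by simp

lemma power_on_S:
  assumes "f \<in> periodic" "f ` S \<subseteq> S"
  obtains N c where "N \<ge> 1" "\<And>x. x \<in> S \<Longrightarrow> (f ^^ N) x = x + c * k"
proof -
  have "x mod k = y mod k" if "x \<in> S" "y \<in> S" "f x mod k = f y mod k" for x y
    using minimal[OF assms(1)] that unfolding S_def by blast
  from power_is_translation[OF assms(1) S_k assms(2) this] that show thesis by metis
qed

text \<open>Members need not commute with the shift by \<open>k\<close>; that they do so on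
  \<open>S\<close> follows from \<open>G_periodic\<close>.\<close>

definition G :: "(int \<Rightarrow> int) set" where "G = {f \<in> forward. f ` S \<subseteq> S}"

lemma GI: "f \<in> forward \<Longrightarrow> (\<And>x. x \<in> S \<Longrightarrow> f x \<in> S) \<Longrightarrow> f \<in> G" by (auto simp: G_def)
lemma GD: "f \<in> G \<Longrightarrow> f \<in> forward" "f \<in> G \<Longrightarrow> x \<in> S \<Longrightarrow> f x \<in> S" by (auto simp: G_def)
lemma G_comp: "f \<in> G \<Longrightarrow> g \<in> G \<Longrightarrow> f \<circ> g \<in> G" by (auto simp: G_def intro: forward_comp)
lemma G_translation: "(\<lambda>x. x + c * k) \<in> G" by (auto simp: G_def forward_translation S_multiple)
lemma G_funpow: "f \<in> G \<Longrightarrow> f ^^ n \<in> G"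
  by (induction n) (use G_translation[of 0] in \<open>auto simp: id_def intro: G_comp\<close>)

text \<open>Far to the left, \<open>f\<close> agrees with a periodic \<open>\<alpha>\<close> that only moves points up. If \<open>\<alpha>\<close> had
  a positive drift, powers of \<open>f\<close> would shift the left end arbitrarily far while fixing the right
  end, against bounded distortion.\<close>

lemma identity_if_identity_right:
  assumes f: "f \<in> G" and right: "\<And>x. x \<in> S \<Longrightarrow> x \<ge> X \<Longrightarrow> f x = x" and x: "x \<in> S"
  shows "f x = x"
proof -
  note fw = GD(1)[OF f]
  have ge: "f x \<ge> x" if "x \<in> S" for x
  proof -
    define m where "m = nat \<bar>X - x\<bar>"
    have "int m * 1 \<le> int m * k" using k by (intro mult_left_mono) auto
    then have "x + int m * k \<ge> X" by (simp add: m_def)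
    then have "f (x + int m * k) = x + int m * k" using right S_multiple that by blast
    then show ?thesis using forward_stepk_nat[OF fw, of x m] by simp
  qed
  obtain \<alpha> Y where \<alpha>: "\<alpha> \<in> periodic" "\<And>x. x \<le> Y \<Longrightarrow> \<alpha> x = f x"
    using limit_left[OF fw] by blast
  have low: "\<exists>m::nat. x + (- int m) * k \<le> Z" for x Z
  proof
    have "int (nat \<bar>Z - x\<bar>) * 1 \<le> int (nat \<bar>Z - x\<bar>) * k" using k by (intro mult_left_mono) auto
    then show "x + (- int (nat \<bar>Z - x\<bar>)) * k \<le> Z" by simp
  qed
  have \<alpha>S: "\<alpha> x \<in> S \<and> \<alpha> x \<ge> x" if "x \<in> S" for x
  proof -
    from low obtain m :: nat where m: "x + (- int m) * k \<le> Y" by blast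
    let ?y = "x + (- int m) * k"
    have y: "?y \<in> S" using that S_multiple by blast
    have "\<alpha> x + (- int m) * k = f ?y"
      using \<alpha>(2)[OF m] periodic_multiple[OF \<alpha>(1), of x "- int m"] by simp
    then show ?thesis using GD(2)[OF f y] ge[OF y] S_multiple[of "\<alpha> x" "- int m"] by simp
  qed
  then obtain N c where N: "N \<ge> 1" "\<And>x. x \<in> S \<Longrightarrow> (\<alpha> ^^ N) x = x + c * k"
    using power_on_S[OF \<alpha>(1)] by blast
  have \<alpha>pow: "(\<alpha> ^^ n) x \<in> S \<and> x \<le> (\<alpha> ^^ n) x" if "x \<in> S" for n x
  proof (induction n)
    case (Suc n)
    then show ?case using \<alpha>S[of "(\<alpha> ^^ n) x"] by auto
  qed (simp add: that)
  have \<alpha>mono: "(\<alpha> ^^ i) x \<le> (\<alpha> ^^ j) x" if "x \<in> S" "i \<le> j" for i j x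
  proof -
    have "(\<alpha> ^^ j) x = (\<alpha> ^^ (j - i)) ((\<alpha> ^^ i) x)" using that(2) by (metis funpow_add le_add_diff_inverse2 o_apply)
    then show ?thesis using \<alpha>pow[of "(\<alpha> ^^ i) x" "j - i"] \<alpha>pow[OF that(1), of i] by simp
  qed
  have iter: "((\<alpha> ^^ N) ^^ m) x = x + (int m * c) * k" if "x \<in> S" for x m
  proof (induction m)
    case (Suc m)
    moreover have "x + (int m * c) * k \<in> S" using S_multiple that by blast
    ultimately show ?case using N(2) by (simp add: algebra_simps)
  qed simp
  have bounded: "\<bar>int m * (c * k)\<bar> \<le> distortion" for m
  proof -
    obtain n :: nat where n: "x + (- int n) * k \<le> Y - (int m * c) * k" using low by blast
    define y where "y = x + (- int n) * k"
    have y: "y \<in> S" "y + (int m * c) * k \<le> Y" using x S_multiple[of x "- int n"] n by (auto simp: y_def)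
    have "i \<le> N * m \<Longrightarrow> (f ^^ i) y = (\<alpha> ^^ i) y" for i
    proof (induction i)
      case (Suc i)
      have "(\<alpha> ^^ i) y \<le> (\<alpha> ^^ (N * m)) y" using \<alpha>mono[OF y(1)] Suc by simp
      also have "\<dots> \<le> Y" using iter[OF y(1), of m] y(2) by (simp add: funpow_mult mult.commute)
      finally show ?case using Suc \<alpha>(2) by simp
    qed simp
    then have l: "(f ^^ (N * m)) y = y + (int m * c) * k"
      using iter[OF y(1), of m] by (simp add: funpow_mult mult.commute)
    obtain n' :: nat where "- x + (- int n') * k \<le> - X" using low by blast
    then have z: "x + int n' * k \<ge> X" by simp
    define z where "z = x + int n' * k"
    have "(f ^^ i) z = z" for i using right[of z] x S_multiple z by (induction i) (auto simp: z_def)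
    then have "\<bar>z - (y + (int m * c) * k) - (z - y)\<bar> \<le> distortion"
      using forward_bound[OF forward_funpow[OF fw], of "N * m" z y] l by simp
    then show ?thesis by (simp add: algebra_simps)
  qed
  from linear_bounded_imp_zero[OF this] have "c = 0" using k by simp
  then have \<alpha>id: "\<alpha> y = y" if "y \<in> S" for y
    using \<alpha>mono[OF that N(1)] N(2)[OF that] \<alpha>S[OF that] by simp
  obtain n :: nat where n: "x + (- int n) * k \<le> Y" using low by blast
  define y where "y = x + (- int n) * k"
  have y: "y \<in> S" "y \<le> Y" "x = y + int n * k" using x S_multiple[of x "- int n"] n by (auto simp: y_def)
  have "f y = y" using \<alpha>(2)[OF y(2)] \<alpha>id[OF y(1)] by simp
  then have "f x \<le> x" using forward_stepk_nat[OF fw, of y n] y(3) by simp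
  with ge[OF x] show ?thesis by simp
qed

text \<open>Far to the right, \<open>f\<close> agrees with a periodic \<open>\<beta>\<close>. As
  \<open>\<beta> ^^ N\<close> is a translation on \<open>S\<close>, the power
  \<open>\<beta> ^^ (N - 1)\<close> inverts \<open>\<beta>\<close> up to that translation. So
  \<open>h\<close> is the identity far to the right on \<open>S\<close>, hence on all of
  \<open>S\<close> by \<open>identity_if_identity_right\<close>, and applying \<open>\<beta>\<close>
  once more recovers \<open>f\<close>.\<close>

lemma G_periodic:
  assumes f: "f \<in> G"
  obtains \<beta> where "\<beta> \<in> periodic" "\<And>x. x \<in> S \<Longrightarrow> f x = \<beta> x"
proof -
  obtain \<beta> X where \<beta>: "\<beta> \<in> periodic" "\<And>x. x \<ge> X \<Longrightarrow> \<beta> x = f x"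
    using limit_right[OF GD(1)[OF f]] by blast
  have \<beta>S: "\<beta> x \<in> S" if "x \<in> S" for x
  proof -
    define m where "m = nat \<bar>X - x\<bar>"
    have "int m * 1 \<le> int m * k" using k by (intro mult_left_mono) auto
    then have "x + int m * k \<ge> X" by (simp add: m_def)
    then have "\<beta> x + int m * k = f (x + int m * k)"
      using \<beta>(2) periodic_multiple[OF \<beta>(1), of x "int m"] by simp
    then show ?thesis using GD(2)[OF f, of "x + int m * k"] S_multiple that by metis
  qed
  then obtain N c where N: "N \<ge> 1" "\<And>x. x \<in> S \<Longrightarrow> (\<beta> ^^ N) x = x + c * k"
    using power_on_S[OF \<beta>(1)] by blast
  have \<beta>G: "\<beta> \<in> G" using \<beta>S periodicD(1)[OF \<beta>(1)] by (auto intro: GI)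
  define h where "h = (\<lambda>x. x + (- c) * k) \<circ> ((\<beta> ^^ (N - 1)) \<circ> f)"
  have h: "h \<in> G" unfolding h_def by (intro G_comp G_translation G_funpow \<beta>G f)
  have pow: "(\<beta> ^^ N) x = (\<beta> ^^ (N - 1)) (\<beta> x)" for x
    using N(1) by (metis Suc_diff_1 funpow_Suc_right o_apply One_nat_def Suc_le_eq)
  have "h x = x" if "x \<in> S" "x \<ge> X" for x
    using N(2)[OF that(1)] \<beta>(2)[OF that(2)] pow[of x] by (simp add: h_def)
  from identity_if_identity_right[OF h this] have h_id: "h x = x" if "x \<in> S" for x
    using that by blast
  have "f x = \<beta> x" if "x \<in> S" for x
  proof -
    have "(\<beta> ^^ (N - 1)) (f x) = (\<beta> ^^ (N - 1)) (\<beta> x)"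
      using h_id[OF that] N(2)[OF that] pow[of x] by (simp add: h_def)
    then have "\<beta> ((\<beta> ^^ (N - 1)) (f x)) = \<beta> ((\<beta> ^^ (N - 1)) (\<beta> x))" by simp
    moreover have "\<beta> ((\<beta> ^^ (N - 1)) y) = (\<beta> ^^ N) y" for y
      using N(1) by (cases N) auto
    ultimately have "f x + c * k = \<beta> x + c * k"
      using N(2)[OF GD(2)[OF f that]] N(2)[OF \<beta>S[OF that]] by simp
    then show ?thesis by simp
  qed
  then show thesis using that \<beta>(1) by blast
qed

lemma G_multiple:
  assumes f: "f \<in> G" and x: "x \<in> S" shows "f (x + j * k) = f x + j * k"
proof -
  obtain \<beta> where "\<beta> \<in> periodic" "\<And>x. x \<in> S \<Longrightarrow> f x = \<beta> x" using G_periodic[OF f] by blast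
  then show ?thesis using x S_multiple periodic_multiple by simp
qed

lemma G_inj:
  assumes f: "f \<in> G" and "x \<in> S" "y \<in> S" "f x mod k = f y mod k" shows "x mod k = y mod k"
proof -
  obtain \<beta> where "\<beta> \<in> periodic" "\<And>x. x \<in> S \<Longrightarrow> f x = \<beta> x" using G_periodic[OF f] by blast
  with assms(2-4) have "\<beta> x mod k = \<beta> y mod k" by metis
  with minimal[OF \<open>\<beta> \<in> periodic\<close>] assms(2,3) show ?thesis unfolding S_def by blast
qed

definition "R = S \<inter> {0..<k}"
definition "\<sigma> f = (\<Sum>x\<in>R. f x - x)" for f :: "int \<Rightarrow> int"

lemma finite_R: "finite R" by (simp add: R_def)

lemma mod_S: "x mod k \<in> S \<longleftrightarrow> x \<in> S"
  using S_multiple[of "x mod k" "x div k"] by simp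

lemma card_R: "card R > 0"
proof -
  have "p 0 mod k \<in> R" using k mod_S[of "p 0"] by (simp add: R_def)
  then show ?thesis using finite_R card_gt_0_iff by blast
qed

text \<open>For \<open>x\<close> in \<open>S\<close>, the displacement \<open>f x - x\<close>
  depends only on \<open>x mod k\<close>, and \<open>g\<close> permutes the residues in
  \<open>R\<close>, being injective on a finite set. So summing the displacement of \<open>f\<close>
  at the points \<open>g x\<close> gives \<open>\<sigma> f\<close> again.\<close>

lemma \<sigma>_comp:
  assumes f: "f \<in> G" and g: "g \<in> G" shows "\<sigma> (f \<circ> g) = \<sigma> f + \<sigma> g"
proof -
  have "inj_on (\<lambda>x. g x mod k) R"
  proof (rule inj_onI)
    fix x y assume "x \<in> R" "y \<in> R" "g x mod k = g y mod k"
    then have "x mod k = y mod k" using G_inj[OF g, of x y] by (simp add: R_def)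
    then show "x = y" using \<open>x \<in> R\<close> \<open>y \<in> R\<close> by (simp add: R_def)
  qed
  moreover have "(\<lambda>x. g x mod k) ` R \<subseteq> R"
    using GD(2)[OF g] mod_S k by (auto simp: R_def)
  ultimately have bij: "bij_betw (\<lambda>x. g x mod k) R R"
    using finite_R by (simp add: bij_betw_def endo_inj_surj)
  have "(\<Sum>x\<in>R. f (g x) - g x) = (\<Sum>x\<in>R. f (g x mod k) - g x mod k)"
  proof (rule sum.cong)
    fix x assume "x \<in> R"
    then have "g x mod k \<in> S" using GD(2)[OF g] mod_S by (auto simp: R_def)
    from G_multiple[OF f this, of "g x div k"]
    have "f (g x) = f (g x mod k) + g x div k * k" by simp
    then show "f (g x) - g x = f (g x mod k) - g x mod k"
      using mod_div_mult_eq[of "g x" k] by linarith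
  qed simp
  also have "\<dots> = (\<Sum>x\<in>R. f x - x)"
    using sum.reindex_bij_betw[OF bij, of "\<lambda>y. f y - y"] .
  finally have "(\<Sum>x\<in>R. f (g x) - g x) = \<sigma> f" by (simp add: \<sigma>_def)
  moreover have "\<sigma> (f \<circ> g) = (\<Sum>x\<in>R. f (g x) - g x) + \<sigma> g"
    by (simp add: \<sigma>_def sum.distrib[symmetric])
  ultimately show ?thesis by simp
qed

lemma \<sigma>_multiple: "\<sigma> (\<lambda>x. x + c * k) = int (card R) * (c * k)"
  by (simp add: \<sigma>_def)

lemma \<sigma>_funpow: "f \<in> G \<Longrightarrow> \<sigma> (f ^^ n) = int n * \<sigma> f"
proof (induction n)
  case (Suc n)
  then show ?case using \<sigma>_comp[OF _ G_funpow[of f n], of f] unfolding funpow.simps(2)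
    by (simp only: algebra_simps of_nat_Suc mult_1_left)
qed (simp add: \<sigma>_def)

text \<open>Some power of \<open>f\<close> is a translation on \<open>S\<close>; as it fixes
  \<open>u\<close>, it is the identity there. By additivity a positive multiple of
  \<open>\<sigma> f\<close> is 0.\<close>

lemma \<sigma>_stabilizer:
  assumes f: "f \<in> G" and u: "u \<in> S" "f u = u" shows "\<sigma> f = 0"
proof -
  obtain \<beta> where \<beta>: "\<beta> \<in> periodic" "\<And>x. x \<in> S \<Longrightarrow> f x = \<beta> x" using G_periodic[OF f] by blast
  have "\<beta> ` S \<subseteq> S" using \<beta>(2) GD(2)[OF f] by auto
  then obtain N c where N: "N \<ge> 1" "\<And>x. x \<in> S \<Longrightarrow> (\<beta> ^^ N) x = x + c * k"
    using power_on_S[OF \<beta>(1)] by blast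
  have pow: "(f ^^ n) x = (\<beta> ^^ n) x \<and> (f ^^ n) x \<in> S" if "x \<in> S" for n x
    using that \<beta>(2) GD(2)[OF f] by (induction n) auto
  have "(f ^^ N) u = u" using u(2) by (induction N) auto
  then have "c = 0" using pow[OF u(1)] N(2)[OF u(1)] k by simp
  then have "(f ^^ N) x = x" if "x \<in> S" for x using pow N(2) that by simp
  then have "\<sigma> (f ^^ N) = 0" by (simp add: \<sigma>_def R_def)
  with \<sigma>_funpow[OF f, of N] N(1) show ?thesis by simp
qed

text \<open>A translation pushed back into \<open>S\<close>. These maps make \<open>G\<close>
  transitive on \<open>S\<close>: for \<open>u\<close> and \<open>v\<close> in \<open>S\<close>,
  \<open>transport (v - u)\<close> takes \<open>u\<close> to \<open>v\<close> because
  \<open>p\<close> fixes \<open>v\<close>.\<close>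

definition "transport t = (\<lambda>x. p (x + t))"

lemma transport_G: "transport t \<in> G"
  using forward_shift[OF periodicD(1)[OF p], of t 0] by (auto intro: GI simp: transport_def)

text \<open>For \<open>v\<close> in \<open>S\<close> this is the total displacement of any member of
  \<open>G\<close> that takes \<open>p 0\<close> to \<open>v\<close>; the choice is immaterial by
  \<open>\<sigma>_eq\<close>.\<close>

definition "height v = \<sigma> (transport (v - p 0))"

text \<open>Followed by the same transport back to \<open>u\<close>, both maps become stabilizers of
  \<open>u\<close>, where \<open>\<sigma>\<close> vanishes; additivity cancels the
  transport.\<close>

lemma \<sigma>_eq:
  assumes "f \<in> G" "g \<in> G" "u \<in> S" "f u = g u" shows "\<sigma> f = \<sigma> g"
proof -
  have fu: "f u \<in> S" using assms GD(2) by blast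
  let ?h = "transport (u - f u)"
  have "\<sigma> (?h \<circ> f) = 0" "\<sigma> (?h \<circ> g) = 0"
    using assms transport_G by (auto intro!: \<sigma>_stabilizer[OF _ assms(3)] G_comp simp: transport_def p_id)
  then show ?thesis using \<sigma>_comp[OF transport_G] assms by (metis add_left_cancel)
qed

lemma height_G:
  assumes g: "g \<in> G" and u: "u \<in> S" shows "height (g u) = height u + \<sigma> g"
proof -
  have "(g \<circ> transport (u - p 0)) (p 0) = transport (g u - p 0) (p 0)"
    using u GD(2)[OF g u] by (simp add: transport_def p_id)
  then have "\<sigma> (g \<circ> transport (u - p 0)) = \<sigma> (transport (g u - p 0))"
    using \<sigma>_eq[OF G_comp[OF g transport_G] transport_G pS] by blast
  then show ?thesis using \<sigma>_comp[OF g transport_G, of "u - p 0"] by (simp add: height_def)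
qed

text \<open>The height of \<open>p z\<close> gains the same amount along every translate of the step from
  \<open>u\<close> to \<open>v\<close>; iterating the step \<open>k\<close> times compares it with translation by
  \<open>k\<close>, which determines the slope.\<close>

lemma height_linear:
  assumes u: "u \<in> S" and v: "v \<in> S"
  shows "height v - height u = int (card R) * (v - u)"
proof -
  define \<theta> where "\<theta> z = height (p z)" for z
  have step: "\<theta> (z + (v - u)) = \<theta> z + (height v - height u)" for z
    using height_G[OF transport_G u, of "z - u"] height_G[OF transport_G v, of "z - u"]
    by (simp add: \<theta>_def transport_def algebra_simps)
  have steps: "\<theta> (z + int m * (v - u)) = \<theta> z + int m * (height v - height u)" for z m
  proof (induction m)
    case (Suc m)
    then show ?case using step[of "z + int m * (v - u)"] by (simp add: algebra_simps)
  qed simp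
  have "\<theta> (z + (v - u) * k) = \<theta> z + int (card R) * ((v - u) * k)" for z
    using height_G[OF G_translation, of "p z" "v - u"] periodic_multiple[OF p, of z "v - u"]
    by (simp add: \<theta>_def \<sigma>_multiple)
  from this[of 0] have "k * (height v - height u) = k * (int (card R) * (v - u))"
    using steps[of 0 "nat k"] k by (simp add: algebra_simps)
  then show ?thesis using k by simp
qed

text \<open>The gain in height from \<open>u\<close> to \<open>g u\<close> is
  \<open>\<sigma> g\<close> by \<open>height_G\<close> and \<open>card R\<close> times the
  displacement by \<open>height_linear\<close>.\<close>

lemma G_is_translation:
  assumes g: "g \<in> G" and "u \<in> S" "v \<in> S" shows "g u - u = g v - v"
proof -
  have "int (card R) * (g x - x) = \<sigma> g" if "x \<in> S" for x
    using height_linear[OF that GD(2)[OF g that]] height_G[OF g that] by simp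
  then have "int (card R) * (g u - u) = int (card R) * (g v - v)" using assms by simp
  then show ?thesis using card_R by simp
qed

lemma S_translate: assumes "x \<in> S" "y \<in> S" "z \<in> S" shows "z + (y - x) \<in> S"
proof -
  have "transport (y - x) x = y" using assms(2) by (simp add: transport_def p_id)
  then have "transport (y - x) z = z + (y - x)"
    using G_is_translation[OF transport_G assms(1,3), of "y - x"] by simp
  then show ?thesis using GD(2)[OF transport_G assms(3), of "y - x"] by simp
qed

text \<open>By \<open>S_translate\<close>, \<open>S\<close> is a coset of a subgroup of the
  integers, and \<open>d\<close> is the least positive element of that subgroup.\<close>

lemma S_progression:
  obtains d where "d \<ge> 1" "S = {x. d dvd x - p 0}"
proof -
  define A where "A = {n::nat. n \<ge> 1 \<and> p 0 + int n \<in> S}"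
  define n where "n = (LEAST n. n \<in> A)"
  have "nat k \<in> A" using k S_multiple[of "p 0" 1] by (simp add: A_def)
  then have n: "n \<in> A" unfolding n_def by (rule LeastI)
  define d where "d = int n"
  have d: "d \<ge> 1" "p 0 + d \<in> S" using n by (auto simp: A_def d_def)
  have mult: "x + j * d \<in> S" if "x \<in> S" for x j
  proof (induction j rule: int_induct[where k=0])
    case (step1 i)
    then show ?case using S_translate[OF pS[of 0] d(2) step1(2)] by (simp add: algebra_simps)
  next
    case (step2 i)
    then show ?case using S_translate[OF d(2) pS[of 0] step2(2)] by (simp add: algebra_simps)
  qed (simp add: that)
  have "d dvd x - p 0" if "x \<in> S" for x
  proof (rule ccontr)
    assume "\<not> d dvd x - p 0"
    then have "(x - p 0) mod d \<ge> 1" using d(1)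
      by (smt (verit) dvd_eq_mod_eq_0 pos_mod_sign)
    moreover have "(x - p 0) mod d < d" using d(1) by simp
    moreover have "p 0 + (x - p 0) mod d = x + (- ((x - p 0) div d)) * d"
      using mod_div_mult_eq[of "x - p 0" d] by (simp add: algebra_simps)
    then have "p 0 + (x - p 0) mod d \<in> S" using mult[OF that] by metis
    ultimately have "nat ((x - p 0) mod d) \<in> A" "nat ((x - p 0) mod d) < n" by (auto simp: A_def d_def)
    then show False unfolding n_def using not_less_Least by blast
  qed
  moreover have "x \<in> S" if "d dvd x - p 0" for x
  proof -
    from that obtain j where "x - p 0 = d * j" ..
    then have "x = p 0 + j * d" by (simp add: algebra_simps)
    then show ?thesis using mult by simp
  qed
  ultimately show thesis using that[OF d(1)] by blast
qed

text \<open>Two reversals preserve the orientation, so \<open>f (f x)\<close> and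
  \<open>f (f x + d)\<close> are translations of \<open>S\<close>, by \<open>c\<close> and
  \<open>c'\<close>. Associativity of composition gives \<open>f (x + c) = f x + c\<close> and then
  \<open>f (x + c') = f x + d\<close>; for a reversing map this forces \<open>c = 0\<close> and
  \<open>c' = - d\<close>.\<close>

lemma backward_on_S:
  assumes f: "f \<in> backward" and fS: "\<And>x. x \<in> S \<Longrightarrow> f x \<in> S" and y: "y \<in> S" and xyd: "x \<in> S"
  shows "f (x + (y - p 0)) = f x - (y - p 0)"
proof -
  define d where "d = y - p 0"
  from f obtain B where fE: "f \<in> E" and B: "\<And>x y. \<bar>f y - f x + (y - x)\<bar> \<le> B"
    unfolding backward_def by blast
  have Sd: "x + d \<in> S" if "x \<in> S" for x unfolding d_def using S_translate[OF pS y that] .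
  have fw: "(\<lambda>x. f (f x + t)) \<in> forward" for t
  proof (rule forwardI)
    show "(\<lambda>x. f (f x + t)) \<in> E"
      using comp[OF shift_mem[OF fE, of t 0] fE] by (simp add: o_def)
    show "\<bar>f (f y + t) - f (f x + t) - (y - x)\<bar> \<le> B + B" for x y
      using B[of "f y + t" "f x + t"] B[of y x] by simp
  qed
  have "(\<lambda>x. f (f x)) \<in> G" "(\<lambda>x. f (f x + d)) \<in> G"
    using fw[of 0] fw[of d] fS Sd by (auto intro: GI)
  from G_is_translation[OF this(1) pS] G_is_translation[OF this(2) pS]
  obtain c c' where c: "\<And>x. x \<in> S \<Longrightarrow> f (f x) = x + c" and c': "\<And>x. x \<in> S \<Longrightarrow> f (f x + d) = x + c'"
    by (metis diff_eq_eq add.commute)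
  have Sc: "x + c \<in> S" "x + c' \<in> S" if "x \<in> S" for x
    using c[OF that] c'[OF that] fS Sd that by metis+
  \<comment> \<open>After \<open>m\<close> iterations a reversing map has moved by about
    \<open>- m * a\<close>, but the hypothesis says \<open>m * b\<close>.\<close>
  have zero: "a + b = 0" if a: "\<And>x. x \<in> S \<Longrightarrow> x + a \<in> S \<and> f (x + a) = f x + b" for a b
  proof -
    have "x + int m * a \<in> S \<and> f (x + int m * a) = f x + int m * b" if "x \<in> S" for x m
    proof (induction m)
      case (Suc m)
      then show ?case using a[of "x + int m * a"] by (simp add: algebra_simps)
    qed (simp add: that)
    then have "\<bar>int m * (a + b)\<bar> \<le> B" for m
      using B[where x="p 0" and y="p 0 + int m * a"] pS by (simp add: algebra_simps)
    then show ?thesis by (rule linear_bounded_imp_zero)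
  qed
  have "x + c \<in> S \<and> f (x + c) = f x + c" if "x \<in> S" for x
    using c[OF that] c[OF fS[OF that]] Sc that by simp
  from zero[OF this] have "c = 0" by simp
  have eq: "f (x + c') = f x + d" if "x \<in> S" for x
    using c'[OF that] c[OF Sd[OF fS[OF that]]] \<open>c = 0\<close> by simp
  then have "c' + d = 0" using zero[of c' d] Sc by blast
  then have "c' = - d" by simp
  then show ?thesis using eq[OF Sd[OF xyd]] by (simp add: d_def)
qed

end

theorem (in compact_monoid) finite_range_or_core:
  obtains (finite) f where "f \<in> E" "finite (range f)"
  | (core) d p where "d \<ge> 1" "p \<in> E" "\<And>x. d dvd p x" "\<And>x. p (d * x) = d * x"
      "\<And>f. f \<in> E \<Longrightarrow> (\<And>x. d dvd f (d * x)) \<Longrightarrow>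
        (\<forall>x. f (d * x) = f 0 + d * x) \<or> (\<forall>x. f (d * x) = f 0 - d * x)"
proof (cases "\<exists>f\<in>E. finite (range f)")
  case True
  then show thesis using finite by blast
next
  case False
  obtain k where k: "k \<ge> 1" "\<And>f x. f \<in> E \<Longrightarrow> \<bar>f (x + 1) - f x\<bar> \<le> k"
    "\<And>f x. f \<in> E \<Longrightarrow> \<bar>f (x + k) - f x\<bar> \<le> k"
    using max_step by blast
  interpret unbounded_compact_monoid E k
    using k False by unfold_locales auto
  obtain p where p: "p \<in> periodic" "\<And>x. p (p x) = p x"
    "\<And>f x y. f \<in> periodic \<Longrightarrow> x \<in> range p \<Longrightarrow> y \<in> range p \<Longrightarrow> f x mod k = f y mod k \<Longrightarrow> x mod k = y mod k"
    using periodic_retraction by blast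
  interpret core E k p
    using p by unfold_locales
  obtain d where d: "d \<ge> 1" "S = {x. d dvd x - p 0}" using S_progression by blast
  \<comment> \<open>Conjugation with the translation by \<open>p 0\<close> turns \<open>S\<close>
    into the set of multiples of \<open>d\<close>.\<close>
  define q where "q x = p (x + p 0) - p 0" for x
  show thesis
  proof (rule core[OF d(1)])
    show "q \<in> E" using shift_mem[OF forwardD[OF periodicD(1)[OF p(1)]], of "p 0" "- p 0"]
      by (simp add: q_def[abs_def])
    show "d dvd q x" for x using pS[of "x + p 0"] d(2) by (simp add: q_def)
    show "q (d * x) = d * x" for x using p_id[of "d * x + p 0"] d(2) by (simp add: q_def)
    fix f assume f: "f \<in> E" "\<And>x. d dvd f (d * x)"
    define g where "g x = f (x + - p 0) + p 0" for x
    have g: "g \<in> E" using shift_mem[OF f(1), of "- p 0" "p 0"] by (simp add: g_def[abs_def])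
    have gS: "g x \<in> S" if "x \<in> S" for x
    proof -
      from that obtain j where "x - p 0 = d * j" unfolding d(2) by blast
      then show ?thesis using f(2)[of j] d(2) by (simp add: g_def)
    qed
    have dS: "d * x + p 0 \<in> S" for x using d(2) by simp
    from forward_or_backward[OF g]
    show "(\<forall>x. f (d * x) = f 0 + d * x) \<or> (\<forall>x. f (d * x) = f 0 - d * x)"
    proof
      assume "g \<in> forward"
      then have "g \<in> G" using gS by (auto intro: GI)
      have "f (d * x) = f 0 + d * x" for x
        using G_is_translation[OF \<open>g \<in> G\<close> dS[of x] pS[of 0]] by (simp add: g_def)
      then show ?thesis by blast
    next
      assume b: "g \<in> backward"
      have "f (d * x) = f 0 - d * x" for x
        using backward_on_S[OF b gS dS[of x] pS[of 0]] by (simp add: g_def)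
      then show ?thesis by blast
    qed
  qed
qed

section \<open>Transfer of first-order definable relations\<close>

text \<open>In a chain, \<open>le k u v\<close> is to be read as \<open>u + k \<le> v\<close>.\<close>

locale chain =
  fixes le :: "int \<Rightarrow> 'a \<Rightarrow> 'a \<Rightarrow> bool"
  assumes trans: "le j u v \<Longrightarrow> le k v w \<Longrightarrow> le (j + k) u w"
    and self [simp]: "le k u u \<longleftrightarrow> k \<le> 0"
    and not_le: "\<not> le k u v \<longleftrightarrow> le (1 - k) v u"
begin

lemma weaken: "le k u v \<Longrightarrow> j \<le> k \<Longrightarrow> le j u v"
  using trans[of "j - k" u u k v] by simp

text \<open>The two hypotheses together express \<open>v = u + d\<close>; this is how an exact
  distance is written in a chain.\<close>

lemma exact_left:
  assumes "le d u v" "le (- d) v u" shows "le k v w \<longleftrightarrow> le (d + k) u w"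
  using trans[OF assms(1), of k w] trans[OF assms(2), of "d + k" w] by auto

lemma exact_right:
  assumes "le d u v" "le (- d) v u" shows "le k w v \<longleftrightarrow> le (k - d) w u"
  using trans[OF _ assms(1), of "k - d" w] trans[OF _ assms(2), of k w] by auto

lemma exact_exists:
  assumes "le i u v" "\<not> le j u v"
  obtains d where "i \<le> d" "d < j" "le d u v" "le (- d) v u"
proof -
  have "i < j" using assms weaken not_less by metis
  define A where "A = {d \<in> {i..j}. le d u v}"
  have "finite A" unfolding A_def by (rule finite_subset[of _ "{i..j}"]) auto
  moreover have "i \<in> A" using assms \<open>i < j\<close> by (simp add: A_def)
  ultimately have A: "finite A" "i \<in> A" .
  define d where "d = Max A"
  have d: "d \<in> A" unfolding d_def using A by (intro Max_in) auto
  then have "d < j" using assms(2) by (auto simp: A_def order.order_iff_strict)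
  have "\<not> le (d + 1) u v"
  proof
    assume "le (d + 1) u v"
    then have "d + 1 \<in> A" using d \<open>d < j\<close> by (auto simp: A_def)
    then show False using Max_ge[OF A(1)] by (fastforce simp: d_def)
  qed
  then have "le (- d) v u" using not_le[of "d + 1" u v] by simp
  then show thesis using that d \<open>d < j\<close> by (auto simp: A_def)
qed

lemma finite_max:
  assumes "finite L" "L \<noteq> {}" obtains y where "y \<in> L" "\<And>z. z \<in> L \<Longrightarrow> le 0 (s z) (s y)"
proof -
  have "\<exists>y\<in>L. \<forall>z\<in>L. le 0 (s z) (s y)" using assms
  proof (induction rule: finite_ne_induct)
    case (insert x F)
    then obtain y where y: "y \<in> F" "\<forall>z\<in>F. le 0 (s z) (s y)" by blast
    show ?case
    proof (cases "le 0 (s x) (s y)")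
      case False
      then have "le 0 (s y) (s x)" using not_le weaken[of 1 _ _ 0] by simp
      then have "\<forall>z\<in>F. le 0 (s z) (s x)" using y(2) trans[of 0 _ _ 0] by fastforce
      then show ?thesis by auto
    qed (use y in auto)
  qed simp
  then show thesis using that by blast
qed

lemma finite_min:
  assumes "finite L" "L \<noteq> {}" obtains y where "y \<in> L" "\<And>z. z \<in> L \<Longrightarrow> le 0 (s y) (s z)"
proof -
  have "\<exists>y\<in>L. \<forall>z\<in>L. le 0 (s y) (s z)" using assms
  proof (induction rule: finite_ne_induct)
    case (insert x F)
    then obtain y where y: "y \<in> F" "\<forall>z\<in>F. le 0 (s y) (s z)" by blast
    show ?case
    proof (cases "le 0 (s y) (s x)")
      case False
      then have "le 0 (s x) (s y)" using not_le weaken[of 1 _ _ 0] by simp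
      then have "\<forall>z\<in>F. le 0 (s x) (s z)" using y(2) trans[of 0 _ _ 0] by fastforce
      then show ?thesis by auto
    qed (use y in auto)
  qed simp
  then show thesis using that by blast
qed

end

text \<open>Extending partial isomorphisms needs translates of points. They exist in \<int> and
  Q.\<int>, but limits of maps are first obtained as mere chains, hence two locales.\<close>

locale shift_chain = chain +
  assumes shift: "\<exists>v. le j u v \<and> le (- j) v u"

definition int_le :: "int \<Rightarrow> int \<Rightarrow> int \<Rightarrow> bool" where "int_le k x y \<longleftrightarrow> x + k \<le> y"

definition qz_le :: "int \<Rightarrow> qz \<Rightarrow> qz \<Rightarrow> bool" where
  "qz_le k u v \<longleftrightarrow> fst u < fst v \<or> fst u = fst v \<and> snd u + k \<le> snd v"

interpretation int: shift_chain int_le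
proof
  show "\<exists>v. int_le j u v \<and> int_le (- j) v u" for j u
    by (rule exI[of _ "u + j"]) (simp add: int_le_def)
qed (auto simp: int_le_def)

interpretation qz: shift_chain qz_le
proof
  show "\<exists>v. qz_le j u v \<and> qz_le (- j) v u" for j u
    by (rule exI[of _ "qz_shift u j"]) (simp add: qz_le_def qz_shift_def)
qed (auto simp: qz_le_def)

lemma less_int_le: "(\<lambda>x y. x < (y::int)) = int_le 1"
  by (auto simp: fun_eq_iff int_le_def)

lemma qz_less_le: "qz_less = qz_le 1"
  by (auto simp: fun_eq_iff qz_less_def qz_le_def)

definition agree :: "(int \<Rightarrow> 'a \<Rightarrow> 'a \<Rightarrow> bool) \<Rightarrow> (int \<Rightarrow> 'b \<Rightarrow> 'b \<Rightarrow> bool) \<Rightarrow> int \<Rightarrow> nat set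
    \<Rightarrow> (nat \<Rightarrow> 'a) \<Rightarrow> (nat \<Rightarrow> 'b) \<Rightarrow> bool" where
  "agree le le' N V s t \<longleftrightarrow>
    (\<forall>x\<in>V. \<forall>y\<in>V. \<forall>k\<in>{-N..N}. le k (s x) (s y) \<longleftrightarrow> le' k (t x) (t y))"

lemma agree_sym: "agree le le' N V s t \<longleftrightarrow> agree le' le N V t s"
  by (auto simp: agree_def)

lemma agree_mono: "agree le le' N V s t \<Longrightarrow> M \<le> N \<Longrightarrow> W \<subseteq> V \<Longrightarrow> agree le le' M W s t"
  by (fastforce simp: agree_def)

text \<open>One round of an Ehrenfeucht-Fraisse game. If \<open>a\<close> is within \<open>N\<close>
  of some point, \<open>b\<close> copies the offset, and offsets up to \<open>N\<close> from
  \<open>a\<close> become offsets up to \<open>2 * N\<close> from that point. Otherwise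
  \<open>a\<close> splits \<open>V\<close> into \<open>L\<close> and \<open>U\<close>, which are at
  least \<open>2 * N + 2\<close> apart, and \<open>b\<close> is placed \<open>N + 1\<close> beyond
  the extreme point of one side, which leaves \<open>N + 1\<close> to the other.\<close>

lemma agree_extend:
  fixes le :: "int \<Rightarrow> 'a \<Rightarrow> 'a \<Rightarrow> bool" and le' :: "int \<Rightarrow> 'b \<Rightarrow> 'b \<Rightarrow> bool"
  assumes "shift_chain le" "shift_chain le'"
    and V: "finite V" "x \<notin> V" and N: "0 \<le> N" and ag: "agree le le' (2 * N + 2) V s t"
  obtains b where "agree le le' N (insert x V) (s(x := a)) (t(x := b))"
proof -
  interpret A: shift_chain le by fact
  interpret B: shift_chain le' by fact
  have ag': "le k (s y) (s z) \<longleftrightarrow> le' k (t y) (t z)" if "y \<in> V" "z \<in> V" "- (2 * N + 2) \<le> k" "k \<le> 2 * N + 2" for k y z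
    using ag that by (auto simp: agree_def)
  have main: "agree le le' N (insert x V) (s(x := a)) (t(x := b))"
    if "\<And>z k. z \<in> V \<Longrightarrow> - N \<le> k \<Longrightarrow> k \<le> N \<Longrightarrow> le k a (s z) \<longleftrightarrow> le' k b (t z)"
      "\<And>z k. z \<in> V \<Longrightarrow> - N \<le> k \<Longrightarrow> k \<le> N \<Longrightarrow> le k (s z) a \<longleftrightarrow> le' k (t z) b" for b
    unfolding agree_def using that ag' V(2) by auto
  consider (near) y d where "y \<in> V" "- N \<le> d" "d \<le> N" "le d (s y) a" "le (- d) a (s y)"
    | (far) "\<And>y. y \<in> V \<Longrightarrow> le (N + 1) (s y) a \<or> le (N + 1) a (s y)"
  proof (cases "\<forall>y\<in>V. le (N + 1) (s y) a \<or> le (N + 1) a (s y)")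
    case True
    then show thesis using far by blast
  next
    case False
    then obtain y where y: "y \<in> V" "\<not> le (N + 1) (s y) a" "\<not> le (N + 1) a (s y)" by blast
    from y(3) have "le (- N) (s y) a" by (simp add: A.not_le)
    from A.exact_exists[OF this y(2)] obtain d where "- N \<le> d" "d < N + 1" "le d (s y) a" "le (- d) a (s y)" .
    then show thesis using near[OF y(1)] by simp
  qed
  then show thesis
  proof cases
    case near
    obtain b where b: "le' d (t y) b" "le' (- d) b (t y)" using B.shift by blast
    have "agree le le' N (insert x V) (s(x := a)) (t(x := b))"
    proof (rule main)
      fix z k assume z: "z \<in> V" and k: "- N \<le> k" "k \<le> N"
      show "le k a (s z) \<longleftrightarrow> le' k b (t z)"
        using A.exact_left[OF near(4,5)] B.exact_left[OF b] ag'[OF near(1) z] near(2,3) k by auto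
      show "le k (s z) a \<longleftrightarrow> le' k (t z) b"
        using A.exact_right[OF near(4,5)] B.exact_right[OF b] ag'[OF z near(1)] near(2,3) k by auto
    qed
    then show thesis by (rule that)
  next
    case far
    define L where "L = {y \<in> V. le (N + 1) (s y) a}"
    define U where "U = {y \<in> V. le (N + 1) a (s y)}"
    have VLU: "V = L \<union> U" using far by (auto simp: L_def U_def)
    have fin: "finite L" "finite U" using V(1) by (auto simp: L_def U_def)
    have "\<exists>b. (\<forall>z\<in>L. le' (N + 1) (t z) b) \<and> (\<forall>z\<in>U. le' (N + 1) b (t z))"
    proof (cases "L = {}")
      case False
      then obtain y where y: "y \<in> L" "\<And>z. z \<in> L \<Longrightarrow> le 0 (s z) (s y)"
        using A.finite_max[OF fin(1)] by metis
      obtain b where b: "le' (N + 1) (t y) b" "le' (- (N + 1)) b (t y)" using B.shift by blast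
      have "le' (N + 1) (t z) b" if "z \<in> L" for z
        using B.trans[OF _ b(1), of 0 "t z"] ag'[of z y 0] y(2)[OF that] y(1) that N by (auto simp: L_def)
      moreover have "le' (N + 1) b (t z)" if "z \<in> U" for z
      proof -
        have "le (N + 1 + (N + 1)) (s y) (s z)" using y(1) that A.trans[of "N + 1" "s y" a "N + 1" "s z"] by (simp add: L_def U_def)
        then have "le' (2 * N + 2) (t y) (t z)"
          using ag'[of y z "2 * N + 2"] y(1) that N by (auto simp: L_def U_def algebra_simps)
        from B.trans[OF b(2) this] show ?thesis by (simp add: algebra_simps)
      qed
      ultimately show ?thesis by blast
    next
      case L: True
      show ?thesis
      proof (cases "U = {}")
        case False
        then obtain y where y: "y \<in> U" "\<And>z. z \<in> U \<Longrightarrow> le 0 (s y) (s z)"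
          using A.finite_min[OF fin(2)] by metis
        obtain b where b: "le' (- (N + 1)) (t y) b" "le' (- (- (N + 1))) b (t y)" using B.shift by blast
        have "le' (N + 1) b (t z)" if "z \<in> U" for z
          using B.trans[OF b(2), of 0 "t z"] ag'[of y z 0] y(2)[OF that] y(1) that N
          by (simp add: U_def add.commute)
        then show ?thesis using L by blast
      qed (use L in auto)
    qed
    then obtain b where b: "\<And>z. z \<in> L \<Longrightarrow> le' (N + 1) (t z) b" "\<And>z. z \<in> U \<Longrightarrow> le' (N + 1) b (t z)" by blast
    have far_apart: "(le k u v \<longleftrightarrow> True) \<and> (le k v u \<longleftrightarrow> False)"
      if "chain le" "le (N + 1) u v" "- N \<le> k" "k \<le> N"
      for le :: "int \<Rightarrow> 'c \<Rightarrow> 'c \<Rightarrow> bool" and u v k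
    proof -
      interpret chain le by fact
      show ?thesis using weaken[OF that(2), of k] weaken[OF that(2), of "1 - k"] not_le[of k v u] that by simp
    qed
    have "agree le le' N (insert x V) (s(x := a)) (t(x := b))"
    proof (rule main)
      fix z k assume z: "z \<in> V" and k: "- N \<le> k" "k \<le> N"
      consider "z \<in> L" | "z \<in> U" using z VLU by blast
      then have "(le k a (s z) \<longleftrightarrow> le' k b (t z)) \<and> (le k (s z) a \<longleftrightarrow> le' k (t z) b)"
      proof cases
        case 1
        then have "le (N + 1) (s z) a" by (simp add: L_def)
        from far_apart[OF A.chain_axioms this k] far_apart[OF B.chain_axioms b(1)[OF 1] k]
        show ?thesis by simp
      next
        case 2
        then have "le (N + 1) a (s z)" by (simp add: U_def)
        from far_apart[OF A.chain_axioms this k] far_apart[OF B.chain_axioms b(2)[OF 2] k]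
        show ?thesis by simp
      qed
      then show "le k a (s z) \<longleftrightarrow> le' k b (t z)" "le k (s z) a \<longleftrightarrow> le' k (t z) b" by auto
    qed
    then show thesis by (rule that)
  qed
qed

fun fv :: "fo \<Rightarrow> nat set" where
  "fv (Less x y) = {x, y}"
| "fv (Eq x y) = {x, y}"
| "fv (Neg \<phi>) = fv \<phi>"
| "fv (Conj \<phi> \<psi>) = fv \<phi> \<union> fv \<psi>"
| "fv (Ex x \<phi>) = fv \<phi> - {x}"

text \<open>The radius up to which distances must agree: atoms compare with offsets 0 and 1, and a
  quantifier costs what \<open>agree_extend\<close> demands.\<close>

fun level :: "fo \<Rightarrow> int" where
  "level (Less x y) = 1"
| "level (Eq x y) = 1"
| "level (Neg \<phi>) = level \<phi>"
| "level (Conj \<phi> \<psi>) = max (level \<phi>) (level \<psi>)"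
| "level (Ex x \<phi>) = 2 * level \<phi> + 2"

lemma finite_fv: "finite (fv \<phi>)" by (induction \<phi>) auto
lemma level_nonneg: "0 \<le> level \<phi>" by (induction \<phi>) auto

lemma fo_sat_agree:
  fixes le :: "int \<Rightarrow> 'a \<Rightarrow> 'a \<Rightarrow> bool" and le' :: "int \<Rightarrow> 'b \<Rightarrow> 'b \<Rightarrow> bool"
  assumes "shift_chain le" "shift_chain le'"
    and eq: "\<And>u v. le 0 u v \<and> le 0 v u \<longleftrightarrow> u = v" "\<And>u v. le' 0 u v \<and> le' 0 v u \<longleftrightarrow> u = v"
    and "agree le le' (level \<phi>) (fv \<phi>) s t"
  shows "fo_sat (le 1) \<phi> s \<longleftrightarrow> fo_sat (le' 1) \<phi> t"
  using assms(5)
proof (induction \<phi> arbitrary: s t)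
  case (Less x y)
  then show ?case by (simp add: agree_def)
next
  case (Eq x y)
  have "s x = s y \<longleftrightarrow> le 0 (s x) (s y) \<and> le 0 (s y) (s x)" using eq(1) by blast
  also have "\<dots> \<longleftrightarrow> le' 0 (t x) (t y) \<and> le' 0 (t y) (t x)" using Eq by (simp add: agree_def)
  finally show ?case using eq(2) by simp
next
  case (Neg \<phi>)
  then show ?case by simp
next
  case (Conj \<phi> \<psi>)
  have "agree le le' (level \<phi>) (fv \<phi>) s t" "agree le le' (level \<psi>) (fv \<psi>) s t"
    using Conj.prems by (auto elim!: agree_mono)
  then show ?case using Conj.IH by simp
next
  case (Ex x \<phi>)
  have ag: "agree le le' (2 * level \<phi> + 2) (fv \<phi> - {x}) s t" using Ex.prems by simp
  have V: "finite (fv \<phi> - {x})" "x \<notin> fv \<phi> - {x}" by (auto simp: finite_fv)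
  have sub: "fv \<phi> \<subseteq> insert x (fv \<phi> - {x})" by blast
  show ?case
  proof
    assume "fo_sat (le 1) (Ex x \<phi>) s"
    then obtain a where a: "fo_sat (le 1) \<phi> (s(x := a))" by auto
    obtain b where "agree le le' (level \<phi>) (insert x (fv \<phi> - {x})) (s(x := a)) (t(x := b))"
      using agree_extend[OF assms(1,2) V level_nonneg ag] by blast
    then show "fo_sat (le' 1) (Ex x \<phi>) t" using Ex.IH a agree_mono[OF _ order_refl sub] by fastforce
  next
    assume "fo_sat (le' 1) (Ex x \<phi>) t"
    then obtain b where b: "fo_sat (le' 1) \<phi> (t(x := b))" by auto
    obtain a where "agree le' le (level \<phi>) (insert x (fv \<phi> - {x})) (t(x := b)) (s(x := a))"
      using agree_extend[OF assms(2,1) V level_nonneg ag[unfolded agree_sym[of le]]] by blast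
    then show "fo_sat (le 1) (Ex x \<phi>) s" using Ex.IH b agree_mono[OF _ order_refl sub] agree_sym by fastforce
  qed
qed

lemma fo_sat_coincidence:
  assumes "\<And>x. x \<in> fv \<phi> \<Longrightarrow> s x = t x" shows "fo_sat lt \<phi> s \<longleftrightarrow> fo_sat lt \<phi> t"
  using assms
proof (induction \<phi> arbitrary: s t)
  case (Ex x \<phi>)
  have "fo_sat lt \<phi> (s(x := a)) \<longleftrightarrow> fo_sat lt \<phi> (t(x := a))" for a
    by (rule Ex.IH) (use Ex.prems in simp)
  then show ?case by simp
next
  case (Conj \<phi> \<psi>)
  show ?case using Conj.IH[of s t] Conj.prems by simp
next
  case (Neg \<phi>)
  show ?case using Neg.IH[of s t] Neg.prems by simp
qed simp_all

lemma fo_sat_Ex_list: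
  "fo_sat lt (foldr Ex ws \<phi>) s \<longleftrightarrow> (\<exists>t. (\<forall>x. x \<notin> set ws \<longrightarrow> t x = s x) \<and> fo_sat lt \<phi> t)"
proof (induction ws arbitrary: s)
  case Nil
  have "(\<forall>x. t x = s x) \<longleftrightarrow> t = s" for t by auto
  then show ?case by simp
next
  case (Cons w ws)
  show ?case
  proof
    assume "fo_sat lt (foldr Ex (w # ws) \<phi>) s"
    then obtain a t where "\<forall>x. x \<notin> set ws \<longrightarrow> t x = (s(w := a)) x" "fo_sat lt \<phi> t" using Cons by auto
    then show "\<exists>t. (\<forall>x. x \<notin> set (w # ws) \<longrightarrow> t x = s x) \<and> fo_sat lt \<phi> t" by (intro exI[of _ t]) auto
  next
    assume "\<exists>t. (\<forall>x. x \<notin> set (w # ws) \<longrightarrow> t x = s x) \<and> fo_sat lt \<phi> t"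
    then obtain t where t: "\<forall>x. x \<notin> set (w # ws) \<longrightarrow> t x = s x" "fo_sat lt \<phi> t" by blast
    then have "\<forall>x. x \<notin> set ws \<longrightarrow> t x = (s(w := t w)) x" by auto
    then have "fo_sat lt (foldr Ex ws \<phi>) (s(w := t w))" using Cons t(2) by blast
    then show "fo_sat lt (foldr Ex (w # ws) \<phi>) s" by auto
  qed
qed

lemma fv_Ex_list: "fv (foldr Ex ws \<phi>) = fv \<phi> - set ws" by (induction ws) auto

text \<open>Free variables of a defining formula beyond its arity are read existentially.\<close>

definition existential_closure :: "nat \<times> fo \<Rightarrow> fo" where
  "existential_closure d = foldr Ex (sorted_list_of_set (fv (snd d) - {..<fst d})) (snd d)"

lemma fv_existential_closure: "fv (existential_closure d) \<subseteq> {..<fst d}"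
  by (auto simp: existential_closure_def fv_Ex_list finite_fv)

text \<open>The values \<open>xs ! x\<close> beyond the length of \<open>xs\<close> are unspecified;
  they do no harm because the free variables of the closure lie below the arity.\<close>

lemma fo_rel_existential_closure: "xs \<in> fo_rel lt d \<longleftrightarrow> length xs = fst d \<and> fo_sat lt (existential_closure d) ((!) xs)"
proof -
  have "(\<exists>s. (\<forall>i < fst d. s i = xs ! i) \<and> fo_sat lt (snd d) s) \<longleftrightarrow>
      (\<exists>t. (\<forall>x. x \<notin> fv (snd d) - {..<fst d} \<longrightarrow> t x = xs ! x) \<and> fo_sat lt (snd d) t)"
  proof
    assume "\<exists>s. (\<forall>i < fst d. s i = xs ! i) \<and> fo_sat lt (snd d) s"
    then obtain s where s: "\<forall>i < fst d. s i = xs ! i" "fo_sat lt (snd d) s" by blast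
    define t where "t x = (if x \<in> fv (snd d) - {..<fst d} then s x else xs ! x)" for x
    have "fo_sat lt (snd d) t" using s by (subst fo_sat_coincidence[of _ t s]) (auto simp: t_def)
    then show "\<exists>t. (\<forall>x. x \<notin> fv (snd d) - {..<fst d} \<longrightarrow> t x = xs ! x) \<and> fo_sat lt (snd d) t"
      by (intro exI[of _ t]) (simp add: t_def)
  qed auto
  then show ?thesis by (simp add: fo_rel_def existential_closure_def fo_sat_Ex_list finite_fv)
qed

definition diff_bound :: "nat \<times> fo \<Rightarrow> int" where "diff_bound d = level (existential_closure d)"

lemma fo_rel_transfer:
  fixes le :: "int \<Rightarrow> 'a \<Rightarrow> 'a \<Rightarrow> bool" and le' :: "int \<Rightarrow> 'b \<Rightarrow> 'b \<Rightarrow> bool"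
  assumes "shift_chain le" "shift_chain le'"
    and eq: "\<And>u v. le 0 u v \<and> le 0 v u \<longleftrightarrow> u = v" "\<And>u v. le' 0 u v \<and> le' 0 v u \<longleftrightarrow> u = v"
    and len: "length xs = length ys"
    and ag: "\<And>i j k. i < length xs \<Longrightarrow> j < length xs \<Longrightarrow> k \<in> {- diff_bound d..diff_bound d} \<Longrightarrow>
      le k (xs ! i) (xs ! j) \<longleftrightarrow> le' k (ys ! i) (ys ! j)"
  shows "xs \<in> fo_rel (le 1) d \<longleftrightarrow> ys \<in> fo_rel (le' 1) d"
proof (cases "length xs = fst d")
  case True
  have "agree le le' (level (existential_closure d)) (fv (existential_closure d)) ((!) xs) ((!) ys)"
    unfolding agree_def
  proof (intro ballI)
    fix i j k assume "i \<in> fv (existential_closure d)" "j \<in> fv (existential_closure d)" "k \<in> {- level (existential_closure d)..level (existential_closure d)}"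
    then show "le k (xs ! i) (xs ! j) \<longleftrightarrow> le' k (ys ! i) (ys ! j)"
      using ag[of i j k] fv_existential_closure[of d] True by (auto simp: diff_bound_def)
  qed
  from fo_sat_agree[OF assms(1-4) this] show ?thesis by (simp add: fo_rel_existential_closure len)
qed (simp add: fo_rel_existential_closure len)

lemma int_le_eq: "int_le 0 u v \<and> int_le 0 v u \<longleftrightarrow> u = v" by (auto simp: int_le_def)
lemma qz_le_eq: "qz_le 0 u v \<and> qz_le 0 v u \<longleftrightarrow> u = v" by (auto simp: qz_le_def prod_eq_iff)

text \<open>Finitely many comparisons decide membership of a fixed tuple, and finitely many eventual
  statements hold jointly.\<close>

lemma eventually_fo_rel_transfer:
  fixes le :: "int \<Rightarrow> 'a \<Rightarrow> 'a \<Rightarrow> bool" and le' :: "int \<Rightarrow> 'b \<Rightarrow> 'b \<Rightarrow> bool"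
  assumes "shift_chain le" "shift_chain le'"
    and eq: "\<And>u v. le 0 u v \<and> le 0 v u \<longleftrightarrow> u = v" "\<And>u v. le' 0 u v \<and> le' 0 v u \<longleftrightarrow> u = v"
    and ev: "\<And>k u v. \<forall>\<^sub>F n in F. le k (a n u) (a n v) \<longleftrightarrow> le' k (b u) (b v)"
  shows "\<forall>\<^sub>F n in F. map (a n) xs \<in> fo_rel (le 1) d \<longleftrightarrow> map b xs \<in> fo_rel (le' 1) d"
proof -
  have "\<forall>\<^sub>F n in F. \<forall>i\<in>{..<length xs}. \<forall>j\<in>{..<length xs}. \<forall>k\<in>{- diff_bound d..diff_bound d}.
      le k (a n (xs ! i)) (a n (xs ! j)) \<longleftrightarrow> le' k (b (xs ! i)) (b (xs ! j))"
    by (intro eventually_ball_finite ballI ev) auto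
  then show ?thesis
    by eventually_elim (rule fo_rel_transfer[OF assms(1-4)], auto)
qed

section \<open>Limits of partial homomorphisms\<close>

lemma summable_half: "summable (\<lambda>n. if P n then (1/2::real) ^ n else 0)"
  by (rule summable_comparison_test'[of "\<lambda>n. (1/2) ^ n" 0]) auto

text \<open>Countability allows a finite total weight under which every point has positive
  mass.\<close>

lemma weight_mono:
  fixes X Y :: "'a::countable set"
  defines "w \<equiv> \<lambda>X. \<Sum>n. if (from_nat n :: 'a) \<in> X then (1/2::real) ^ n else (0::real)"
  shows "X \<subseteq> Y \<Longrightarrow> w X \<le> w Y" "X \<subseteq> Y \<Longrightarrow> x \<in> Y - X \<Longrightarrow> w X < w Y"
proof -
  assume XY: "X \<subseteq> Y"
  show "w X \<le> w Y" unfolding w_def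
    by (rule suminf_le[OF _ summable_half summable_half]) (use XY in auto)
next
  assume XY: "X \<subseteq> Y" and x: "x \<in> Y - X"
  define f g where "f n = (if from_nat n \<in> X then (1/2::real) ^ n else 0)"
    and "g n = (if from_nat n \<in> Y then (1/2::real) ^ n else 0)" for n
  have s: "summable f" "summable g" using summable_half by (auto simp: f_def[abs_def] g_def[abs_def])
  have "0 < (\<Sum>n. g n - f n)"
    by (rule suminf_pos2[OF summable_diff[OF s(2,1)], where i="to_nat x"])
      (use XY x in \<open>auto simp: f_def g_def\<close>)
  also have "\<dots> = suminf g - suminf f" using suminf_diff[OF s(2,1)] by simp
  also have "\<dots> = w Y - w X" by (simp add: w_def f_def[abs_def] g_def[abs_def])
  finally show "w X < w Y" by simp
qed

text \<open>Points at finite distance form a block. Weighting the \<open>n\<close>-th point by \<open>(1/2)^n\<close>, the points below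
  a block and the points not above it have different total weights; any rational strictly between
  the two is a suitable copy for the block.\<close>

lemma chain_embedding:
  fixes le :: "int \<Rightarrow> 'a::countable \<Rightarrow> 'a \<Rightarrow> bool"
  assumes "chain le"
  obtains e :: "'a \<Rightarrow> qz" where "\<And>k u v. qz_le k (e u) (e v) \<longleftrightarrow> le k u v"
proof -
  interpret chain le by fact
  define below where "below u v \<longleftrightarrow> (\<forall>k. le k u v)" for u v
  define lo up where "lo u = {x. below x u}" and "up u = {x. \<not> below u x}" for u
  define w where "w X = (\<Sum>n. if (from_nat n :: 'a) \<in> X then (1/2::real) ^ n else (0::real))" for X
  have not_below: "\<exists>k. le k v u" if "\<not> below u v" for u v
    using that not_le by (auto simp: below_def)
  have below_le: "below u v" if "below u x" "le k x v" for u x v k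
    unfolding below_def
  proof
    fix j show "le j u v" using trans[of "j - k" u x k v] that by (simp add: below_def)
  qed
  have le_below: "below u v" if "le k u x" "below x v" for u x v k
    unfolding below_def
  proof
    fix j show "le j u v" using trans[of k u x "j - k" v] that by (simp add: below_def)
  qed
  have irrefl: "\<not> below u u" for u using self[of 1 u] by (auto simp: below_def simp del: self)
  have lo_up: "w (lo u) < w (up u)" for u
  proof -
    have "lo u \<subseteq> up u"
    proof
      fix x assume "x \<in> lo u"
      then have "below x u" by (simp add: lo_def)
      then have "\<not> below u x" using below_le irrefl by (meson below_def)
      then show "x \<in> up u" by (simp add: up_def)
    qed
    moreover have "u \<in> up u - lo u" using irrefl by (auto simp: lo_def up_def)
    ultimately show ?thesis unfolding w_def by (rule weight_mono(2))
  qed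
  define \<rho> where "\<rho> u = (SOME q::rat. w (lo u) < of_rat q \<and> of_rat q < w (up u))" for u
  have \<rho>: "w (lo u) < of_rat (\<rho> u)" "of_rat (\<rho> u) < w (up u)" for u
    using someI_ex[OF of_rat_dense[OF lo_up[of u]]] unfolding \<rho>_def by blast+
  have \<rho>_less: "\<rho> u < \<rho> v" if "below u v" for u v
  proof -
    have "up u \<subseteq> lo v" using not_below le_below that by (fastforce simp: up_def lo_def)
    then have "w (up u) \<le> w (lo v)" unfolding w_def by (rule weight_mono(1))
    then have "real_of_rat (\<rho> u) < of_rat (\<rho> v)" using \<rho>(2)[of u] \<rho>(1)[of v] by linarith
    then show ?thesis by (simp add: of_rat_less)
  qed
  have \<rho>_eq: "\<rho> u = \<rho> v" if "\<not> below u v" "\<not> below v u" for u v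
  proof -
    from not_below[OF that(2)] not_below[OF that(1)] obtain k j where kj: "le k u v" "le j v u" by blast
    have "below x u \<longleftrightarrow> below x v" "below u x \<longleftrightarrow> below v x" for x
      using below_le[OF _ kj(1)] below_le[OF _ kj(2)] le_below[OF kj(1)] le_below[OF kj(2)] by blast+
    then have "lo u = lo v" "up u = up v" by (simp_all add: lo_def up_def)
    then show ?thesis by (simp add: \<rho>_def)
  qed
  have eq_iff: "\<rho> u = \<rho> v \<longleftrightarrow> \<not> below u v \<and> \<not> below v u" for u v
    using \<rho>_eq \<rho>_less by (metis less_irrefl)
  define rep where "rep u = (SOME v. \<rho> v = \<rho> u)" for u
  have rep: "\<rho> (rep u) = \<rho> u" for u unfolding rep_def by (rule someI) simp
  have "\<exists>d. le d (rep u) u \<and> le (- d) u (rep u)" for u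
  proof -
    have "\<not> below (rep u) u" "\<not> below u (rep u)" using rep eq_iff by auto
    then obtain i j where "le i (rep u) u" "\<not> le j (rep u) u" using not_below by (metis below_def)
    then show ?thesis using exact_exists by metis
  qed
  then obtain off where off: "\<And>u. le (off u) (rep u) u" "\<And>u. le (- off u) u (rep u)" by metis
  have "qz_le k (\<rho> u, off u) (\<rho> v, off v) \<longleftrightarrow> le k u v" for k u v
  proof -
    consider "below u v" | "below v u" | "\<rho> u = \<rho> v" using eq_iff by blast
    then show ?thesis
    proof cases
      case 1
      then show ?thesis using \<rho>_less[OF 1] by (simp add: qz_le_def below_def)
    next
      case 2
      then have "\<not> le k u v" using not_le by (simp add: below_def)
      then show ?thesis using \<rho>_less[OF 2] by (simp add: qz_le_def)
    next
      case 3
      then have r: "rep v = rep u" by (simp add: rep_def)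
      have "le k u v \<longleftrightarrow> le (off u + k) (rep u) v" using exact_left[OF off] .
      also have "\<dots> \<longleftrightarrow> le (off u + k - off v) (rep u) (rep u)"
        using exact_right[OF off[of v]] r by simp
      finally show ?thesis using 3 by (simp add: qz_le_def)
    qed
  qed
  then show thesis using that[of "\<lambda>u. (\<rho> u, off u)"] by blast
qed

text \<open>Each single question is settled along a subsequence, and a tail of the diagonal sequence
  is a subsequence of each of the successive choices.\<close>

lemma decided_subsequence:
  fixes Q :: "nat \<Rightarrow> 'c::countable \<Rightarrow> bool"
  obtains r :: "nat \<Rightarrow> nat" and b where "strict_mono r" "\<And>c. \<forall>\<^sub>F n in sequentially. Q (r n) c \<longleftrightarrow> b c"
proof -
  define P where "P m s \<longleftrightarrow> (\<exists>b. \<forall>\<^sub>F n in sequentially. Q (s n) (from_nat m :: 'c) \<longleftrightarrow> b)"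
    for m and s :: "nat \<Rightarrow> nat"
  interpret subseqs P
  proof
    fix m and s :: "nat \<Rightarrow> nat"
    show "\<exists>r'. strict_mono r' \<and> P m (s \<circ> r')"
    proof (cases "\<forall>\<^sub>F n in sequentially. \<not> Q (s n) (from_nat m)")
      case True
      then show ?thesis by (intro exI[of _ id]) (auto simp: P_def strict_mono_def intro!: exI[of _ False])
    next
      case False
      from not_eventually_sequentiallyD[OF this] obtain r :: "nat \<Rightarrow> nat" where "strict_mono r" "\<forall>n. Q (s (r n)) (from_nat m)"
        by auto
      then show ?thesis by (intro exI[of _ r]) (auto simp: P_def intro!: exI[of _ True])
    qed
  qed
  have "P m (diagseq \<circ> ((+) (Suc m)))" for m
  proof (rule diagseq_holds)
    fix r s :: "nat \<Rightarrow> nat" and n assume "strict_mono r" "P n s"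
    then show "P n (s \<circ> r)" using eventually_subseq unfolding P_def o_def by blast
  qed
  then have "\<exists>b. \<forall>\<^sub>F n in sequentially. Q (diagseq (Suc m + n)) (from_nat m :: 'c) \<longleftrightarrow> b" for m
    unfolding P_def o_def .
  moreover have "(\<forall>\<^sub>F n in sequentially. Q (diagseq (Suc m + n)) (from_nat m) \<longleftrightarrow> b) \<longleftrightarrow>
      (\<forall>\<^sub>F n in sequentially. Q (diagseq n) (from_nat m) \<longleftrightarrow> b)" for m b
    using eventually_sequentially_seg[of "\<lambda>n. Q (diagseq n) (from_nat m) \<longleftrightarrow> b" "Suc m"]
    by (simp add: add.commute)
  ultimately have "\<exists>b. \<forall>\<^sub>F n in sequentially. Q (diagseq n) (from_nat m :: 'c) \<longleftrightarrow> b" for m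
    by metis
  then have "\<exists>b. \<forall>\<^sub>F n in sequentially. Q (diagseq n) c \<longleftrightarrow> b" for c
    by (metis from_nat_to_nat)
  then show thesis using that subseq_diagseq by metis
qed

text \<open>All countably many comparisons are settled along one subsequence. The limiting answers
  inherit the chain axioms from \<int>, and \<open>chain_embedding\<close> realizes them in
  Q.\<int>; distances that tend to infinity become distances between different copies.\<close>

lemma converging_subsequence:
  fixes F :: "nat \<Rightarrow> 'a::countable \<Rightarrow> int"
  obtains r :: "nat \<Rightarrow> nat" and e :: "'a \<Rightarrow> qz" where "strict_mono r"
    "\<And>k u v. \<forall>\<^sub>F n in sequentially. int_le k (F (r n) u) (F (r n) v) \<longleftrightarrow> qz_le k (e u) (e v)"
proof -
  obtain r :: "nat \<Rightarrow> nat" and b where r: "strict_mono r"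
    "\<And>c. \<forall>\<^sub>F n in sequentially. (case c of (k, u, v) \<Rightarrow> int_le k (F (r n) u) (F (r n) v)) \<longleftrightarrow> b c"
    using decided_subsequence[of "\<lambda>n (k, u, v). int_le k (F n u) (F n v)"] by blast
  define le where "le k u v = b (k, u, v)" for k u v
  have le: "\<forall>\<^sub>F n in sequentially. int_le k (F (r n) u) (F (r n) v) \<longleftrightarrow> le k u v" for k u v
    using r(2)[of "(k, u, v)"] by (simp add: le_def)
  have "chain le"
  proof
    fix j k u v w
    assume *: "le j u v" "le k v w"
    from le[of j u v] le[of k v w] le[of "j + k" u w]
    have "\<forall>\<^sub>F n in sequentially. le (j + k) u w"
      by eventually_elim (use * in \<open>auto simp: int_le_def\<close>)
    then show "le (j + k) u w" by simp
  next
    fix k u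
    from le[of k u u] have "\<forall>\<^sub>F n in sequentially. le k u u \<longleftrightarrow> k \<le> 0"
      by eventually_elim (auto simp: int_le_def)
    then show "le k u u \<longleftrightarrow> k \<le> 0" by simp
  next
    fix k u v
    from le[of k u v] le[of "1 - k" v u] have "\<forall>\<^sub>F n in sequentially. \<not> le k u v \<longleftrightarrow> le (1 - k) v u"
      by eventually_elim (auto simp: int_le_def)
    then show "\<not> le k u v \<longleftrightarrow> le (1 - k) v u" by simp
  qed
  then obtain e :: "'a \<Rightarrow> qz" where "\<And>k u v. qz_le k (e u) (e v) \<longleftrightarrow> le k u v"
    using chain_embedding by blast
  then show thesis using that[OF r(1), of e] le by simp
qed

text \<open>The copy over \<open>a\<close> is placed near \<open>n * a\<close>, so distances inside
  a copy are exact and those between copies tend to infinity.\<close>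

definition approx :: "nat \<Rightarrow> qz \<Rightarrow> int" where "approx n u = \<lfloor>of_nat n * fst u\<rfloor> + snd u"

lemma approx_far:
  assumes "fst u < fst v"
  shows "\<forall>\<^sub>F n in sequentially. approx n u + k \<le> approx n v"
proof -
  define c where "c = fst v - fst u"
  define m where "m = k + snd u - snd v"
  have c: "c > 0" using assms by (simp add: c_def)
  obtain N :: nat where N: "of_int m < of_nat N * c" using c ex_less_of_nat_mult by blast
  from eventually_ge_at_top[of N] show ?thesis
  proof eventually_elim
    case (elim n)
    then have "of_nat N * c \<le> of_nat n * c" using c by (intro mult_right_mono) auto
    with N have "of_int m + of_nat n * fst u \<le> of_nat n * fst v" by (simp add: c_def algebra_simps)
    then have "\<lfloor>of_nat n * fst u + of_int m\<rfloor> \<le> \<lfloor>of_nat n * fst v\<rfloor>"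
      by (intro floor_mono) (simp add: add.commute)
    then show ?case by (simp add: approx_def m_def)
  qed
qed

lemma approx_converges:
  "\<forall>\<^sub>F n in sequentially. int_le k (approx n u) (approx n v) \<longleftrightarrow> qz_le k u v"
proof -
  consider "fst u < fst v" | "fst v < fst u" | "fst u = fst v" by linarith
  then show ?thesis
  proof cases
    case 1
    from approx_far[OF 1, of k] show ?thesis
      by eventually_elim (use 1 in \<open>simp add: int_le_def qz_le_def\<close>)
  next
    case 2
    from approx_far[OF 2, of "1 - k"] show ?thesis
      by eventually_elim (use 2 in \<open>simp add: int_le_def qz_le_def\<close>)
  next
    case 3
    then show ?thesis by (simp add: int_le_def qz_le_def approx_def)
  qed
qed

text \<open>Linear growth in \<open>n\<close> is eventually dominated by the square; this is the
  window on which \<open>limit_endomorphism\<close> needs homomorphisms.\<close>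

lemma approx_bounded: "\<forall>\<^sub>F n in sequentially. approx n u \<in> {- int (n * n)..int (n * n)}"
proof -
  define c where "c = \<lceil>\<bar>fst u\<bar>\<rceil> + \<bar>snd u\<bar> + 1"
  have c: "c \<ge> 0" by (simp add: c_def)
  from eventually_ge_at_top[of "nat c"] eventually_ge_at_top[of 1] show ?thesis
  proof eventually_elim
    case (elim n)
    have "int n * c \<le> int n * int n" using elim(1) by (intro mult_left_mono) auto
    moreover have "\<bar>snd u\<bar> + 1 \<le> int n * (\<bar>snd u\<bar> + 1)"
      using elim(2) mult_right_mono[of 1 "int n" "\<bar>snd u\<bar> + 1"] by simp
    moreover have "\<bar>\<lfloor>of_nat n * fst u\<rfloor>\<bar> \<le> int n * \<lceil>\<bar>fst u\<bar>\<rceil> + 0"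
    proof -
      have "\<bar>of_nat n * fst u\<bar> \<le> of_nat n * of_int \<lceil>\<bar>fst u\<bar>\<rceil>"
        by (simp add: abs_mult mult_left_mono)
      then have "of_nat n * fst u \<le> of_int (int n * \<lceil>\<bar>fst u\<bar>\<rceil>)" "of_int (- (int n * \<lceil>\<bar>fst u\<bar>\<rceil>)) \<le> of_nat n * fst u"
        by (simp_all add: abs_le_iff)
      then have "\<lfloor>of_nat n * fst u\<rfloor> \<le> \<lfloor>of_int (int n * \<lceil>\<bar>fst u\<bar>\<rceil>) :: rat\<rfloor>"
        "- (int n * \<lceil>\<bar>fst u\<bar>\<rceil>) \<le> \<lfloor>of_nat n * fst u\<rfloor>"
        by (simp only: floor_mono, simp only: le_floor_iff)
      then have "\<lfloor>of_nat n * fst u\<rfloor> \<le> int n * \<lceil>\<bar>fst u\<bar>\<rceil>" "- (int n * \<lceil>\<bar>fst u\<bar>\<rceil>) \<le> \<lfloor>of_nat n * fst u\<rfloor>"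
        by (simp_all only: floor_of_int)
      then show ?thesis by linarith
    qed
    ultimately have "\<bar>\<lfloor>of_nat n * fst u\<rfloor> + snd u\<bar> \<le> int n * int n"
      unfolding c_def distrib_left by linarith
    then show ?case by (simp add: approx_def abs_le_iff)
  qed
qed

section \<open>Endomorphisms of the integer structure as limits\<close>

definition rel :: "(nat \<times> fo) list \<Rightarrow> nat \<Rightarrow> int list set" where
  "rel \<Phi> i = fo_rel (<) (\<Phi> ! i)"

definition endos :: "(nat \<times> fo) list \<Rightarrow> (int \<Rightarrow> int) set" where
  "endos \<Phi> = {f. \<forall>i < length \<Phi>. \<forall>t \<in> rel \<Phi> i. map f t \<in> rel \<Phi> i}"

definition partial_hom :: "(nat \<times> fo) list \<Rightarrow> nat \<Rightarrow> (int \<Rightarrow> int) \<Rightarrow> bool" where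
  "partial_hom \<Phi> n f \<longleftrightarrow>
    (\<forall>i < length \<Phi>. \<forall>t \<in> rel \<Phi> i. set t \<subseteq> {- int n..int n} \<longrightarrow> map f t \<in> rel \<Phi> i)"

lemma rel_alt: "rel \<Phi> i = fo_rel (int_le 1) (\<Phi> ! i)"
  by (simp add: rel_def less_int_le)

lemma rel_eventually:
  assumes "\<And>u v. \<forall>\<^sub>F n in F. a n u - a n v = b u - b v"
  shows "\<forall>\<^sub>F n in F. map (a n) t \<in> rel \<Phi> i \<longleftrightarrow> map b t \<in> rel \<Phi> i"
  unfolding rel_alt
proof (rule eventually_fo_rel_transfer[OF int.shift_chain_axioms int.shift_chain_axioms int_le_eq int_le_eq])
  fix k u v
  from assms[of u v] show "\<forall>\<^sub>F n in F. int_le k (a n u) (a n v) \<longleftrightarrow> int_le k (b u) (b v)"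
    by eventually_elim (auto simp: int_le_def)
qed

text \<open>The maps \<open>H n\<close> are defined on all of Q.\<int> and eventually preserve any
  given tuple; by transfer on both sides their limit \<open>e\<close> is an endomorphism. Rank one
  keeps consecutive points, hence the whole copy over 0, in one copy, so differences there converge
  to integers. On this copy \<open>approx n\<close> only drops the first coordinate, so these are
  differences of the given maps.\<close>

lemma limit_endomorphism:
  assumes rank: "\<And>e. q_endo \<Phi> e \<Longrightarrow> k_bounded 1 e" and F: "\<And>n. partial_hom \<Phi> n (F n)"
  obtains f and r :: "nat \<Rightarrow> nat" where "f \<in> endos \<Phi>" "strict_mono r"
    "\<And>u v. \<forall>\<^sub>F n in sequentially. F (r n) u - F (r n) v = f u - f v"
proof -
  define H where "H n u = F (n * n) (approx n u)" for n u
  obtain r :: "nat \<Rightarrow> nat" and e :: "qz \<Rightarrow> qz" where r: "strict_mono r"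
    "\<And>k u v. \<forall>\<^sub>F n in sequentially. int_le k (H (r n) u) (H (r n) v) \<longleftrightarrow> qz_le k (e u) (e v)"
    using converging_subsequence[of H] by blast
  have "q_endo \<Phi> e"
    unfolding q_endo_def
  proof (intro allI impI ballI)
    fix i xs assume i: "i < length \<Phi>" and "xs \<in> snd (qstruct \<Phi>) i"
    then have xs: "map (\<lambda>x. x) xs \<in> fo_rel (qz_le 1) (\<Phi> ! i)" by (simp add: qstruct_def qz_less_le)
    have "\<forall>\<^sub>F n in sequentially. map (approx n) xs \<in> fo_rel (int_le 1) (\<Phi> ! i) \<longleftrightarrow>
        map (\<lambda>x. x) xs \<in> fo_rel (qz_le 1) (\<Phi> ! i)"
      by (rule eventually_fo_rel_transfer[OF int.shift_chain_axioms qz.shift_chain_axioms int_le_eq qz_le_eq])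
        (rule approx_converges)
    moreover have "\<forall>\<^sub>F n in sequentially. \<forall>u \<in> set xs. approx n u \<in> {- int (n * n)..int (n * n)}"
      by (intro eventually_ball_finite ballI approx_bounded) simp
    ultimately have "\<forall>\<^sub>F n in sequentially. map (H n) xs \<in> rel \<Phi> i"
    proof eventually_elim
      case (elim n)
      then have "map (approx n) xs \<in> rel \<Phi> i" using xs by (simp add: rel_alt)
      moreover have "set (map (approx n) xs) \<subseteq> {- int (n * n)..int (n * n)}" using elim(2) by auto
      ultimately have "map (F (n * n)) (map (approx n) xs) \<in> rel \<Phi> i"
        using F[of "n * n"] i unfolding partial_hom_def by blast
      then show ?case by (simp add: H_def[abs_def] o_def)
    qed
    then have "\<forall>\<^sub>F n in sequentially. map (H (r n)) xs \<in> rel \<Phi> i"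
      by (rule eventually_subseq[OF r(1)])
    moreover have "\<forall>\<^sub>F n in sequentially. map (H (r n)) xs \<in> fo_rel (int_le 1) (\<Phi> ! i) \<longleftrightarrow>
        map e xs \<in> fo_rel (qz_le 1) (\<Phi> ! i)"
      by (rule eventually_fo_rel_transfer[OF int.shift_chain_axioms qz.shift_chain_axioms int_le_eq qz_le_eq])
        (rule r(2))
    ultimately have "\<forall>\<^sub>F n in sequentially. map e xs \<in> fo_rel (qz_le 1) (\<Phi> ! i)"
      by eventually_elim (simp add: rel_alt)
    then show "map e xs \<in> snd (qstruct \<Phi>) i" using i by (simp add: qstruct_def qz_less_le)
  qed
  then have "fst (e (qz_shift u 1)) = fst (e u)" for u
    using rank[OF \<open>q_endo \<Phi> e\<close>] unfolding k_bounded_def kc_bounded_def by (metis of_nat_1)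
  from this[of "(0, z)" for z] have copy1: "fst (e (0, z + 1)) = fst (e (0, z))" for z
    by (simp add: qz_shift_def)
  have copy: "fst (e (0, z)) = fst (e (0, 0))" for z
  proof (induction z rule: int_induct[where k=0])
    case (step2 i)
    then show ?case using copy1[of "i - 1"] by simp
  qed (use copy1 in auto)
  define f where "f z = snd (e (0, z))" for z
  define r' where "r' n = r n * r n" for n
  have mono: "strict_mono r'"
    using r(1) by (auto simp: strict_mono_def r'_def intro!: mult_strict_mono')
  have diff: "\<forall>\<^sub>F n in sequentially. F (r' n) u - F (r' n) v = f u - f v" for u v
  proof -
    from r(2)[of "f v - f u" "(0, u)" "(0, v)"] r(2)[of "f v - f u + 1" "(0, u)" "(0, v)"]
    show ?thesis
      by eventually_elim
        (use copy[of u] copy[of v] in \<open>auto simp: int_le_def qz_le_def H_def approx_def r'_def f_def\<close>)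
  qed
  have "f \<in> endos \<Phi>"
    unfolding endos_def
  proof (intro CollectI allI impI ballI)
    fix i t assume i: "i < length \<Phi>" and t: "t \<in> rel \<Phi> i"
    define b where "b = nat (Max (insert 0 (abs ` set t)))"
    have b: "\<bar>x\<bar> \<le> int b" if "x \<in> set t" for x
    proof -
      have "\<bar>x\<bar> \<le> Max (insert 0 (abs ` set t))" using that by (intro Max_ge) auto
      then show ?thesis unfolding b_def by linarith
    qed
    have "\<forall>\<^sub>F n in sequentially. map (F (r' n)) t \<in> rel \<Phi> i \<longleftrightarrow> map f t \<in> rel \<Phi> i"
      by (rule rel_eventually) (rule diff)
    with eventually_ge_at_top[of b]
    have "\<forall>\<^sub>F n in sequentially. map f t \<in> rel \<Phi> i"
    proof eventually_elim
      case (elim n)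
      have "n \<le> r' n" using mono by (rule strict_mono_imp_increasing)
      then have "set t \<subseteq> {- int (r' n)..int (r' n)}" using b elim(1) by (fastforce simp: abs_le_iff)
      then show ?case using F[of "r' n"] elim(2) i t unfolding partial_hom_def by blast
    qed
    then show "map f t \<in> rel \<Phi> i" by simp
  qed
  then show thesis using that[OF _ mono diff] by blast
qed

lemma rel_translate: "map (\<lambda>x. x + c) t \<in> rel \<Phi> i \<longleftrightarrow> t \<in> rel \<Phi> i"
  using rel_eventually[of "\<lambda>_ x. x + c" "\<lambda>x. x" sequentially t \<Phi> i] by simp

lemma endos_compact_monoid:
  assumes rank: "\<And>e. q_endo \<Phi> e \<Longrightarrow> k_bounded 1 e"
  shows "compact_monoid (endos \<Phi>)"
proof
  show "(\<lambda>x. x + c) \<in> endos \<Phi>" for c by (simp add: endos_def rel_translate)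
  show "f \<circ> g \<in> endos \<Phi>" if "f \<in> endos \<Phi>" "g \<in> endos \<Phi>" for f g
    using that unfolding endos_def by (simp add: map_comp_map[symmetric] del: map_comp_map map_map)
next
  fix F :: "nat \<Rightarrow> int \<Rightarrow> int"
  assume "\<And>n. F n \<in> endos \<Phi>"
  then have "partial_hom \<Phi> n (F n)" for n by (simp add: endos_def partial_hom_def)
  then obtain f and r :: "nat \<Rightarrow> nat" where "f \<in> endos \<Phi>" "strict_mono r"
    "\<And>u v. \<forall>\<^sub>F n in sequentially. F (r n) u - F (r n) v = f u - f v"
    using limit_endomorphism[OF rank, where F=F] by blast
  then show "\<exists>f\<in>endos \<Phi>. \<exists>r. strict_mono r \<and>
      (\<forall>u v. \<forall>\<^sub>F n in sequentially. F (r n) u - F (r n) v = f u - f v)"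
    by blast
qed

section \<open>Definability and the classification\<close>

definition expressible :: "((nat \<Rightarrow> int) \<Rightarrow> bool) \<Rightarrow> bool" where
  "expressible X \<longleftrightarrow> (\<exists>\<phi>. \<forall>s. fo_sat (<) \<phi> s \<longleftrightarrow> X s)"

lemma expressible_not: "expressible X \<Longrightarrow> expressible (\<lambda>s. \<not> X s)"
  unfolding expressible_def by (metis fo_sat.simps(3))

lemma expressible_conj: "expressible X \<Longrightarrow> expressible Y \<Longrightarrow> expressible (\<lambda>s. X s \<and> Y s)"
  unfolding expressible_def by (metis fo_sat.simps(4))

lemma expressible_True: "expressible (\<lambda>s. True)"
  unfolding expressible_def by (rule exI[of _ "Neg (Less 0 0)"]) simp

lemma expressible_ball:
  assumes "finite A" "\<And>a. a \<in> A \<Longrightarrow> expressible (X a)" shows "expressible (\<lambda>s. \<forall>a\<in>A. X a s)"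
  using assms by (induction A rule: finite_induct) (auto intro: expressible_True expressible_conj)

lemma expressible_bex:
  assumes "finite A" "\<And>a. a \<in> A \<Longrightarrow> expressible (X a)" shows "expressible (\<lambda>s. \<exists>a\<in>A. X a s)"
  using expressible_not[OF expressible_ball[of A "\<lambda>a s. \<not> X a s"]] assms by (simp add: expressible_not)

lemma expressible_eq_const: "expressible X \<Longrightarrow> expressible (\<lambda>s. X s \<longleftrightarrow> b)"
  by (cases b) (simp_all add: expressible_not)

lemma expressible_le: "expressible (\<lambda>s. s i + k \<le> s j)"
proof -
  have nonneg: "expressible (\<lambda>s. s i + int m \<le> s j)" for m i j
  proof (induction m arbitrary: i)
    case 0
    show ?case unfolding expressible_def by (rule exI[of _ "Neg (Less j i)"]) auto
  next
    case (Suc m)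
    \<comment> \<open>A variable distinct from \<open>i\<close> and \<open>j\<close>; the induction
      is general in \<open>i\<close> so that \<open>w\<close> can take its place.\<close>
    define w where "w = Suc (i + j)"
    obtain \<phi> where \<phi>: "\<And>s. fo_sat (<) \<phi> s \<longleftrightarrow> s w + int m \<le> s j"
      using Suc[of w] unfolding expressible_def by blast
    have w: "w \<noteq> i" "w \<noteq> j" by (auto simp: w_def)
    have "fo_sat (<) (Ex w (Conj (Less i w) \<phi>)) s \<longleftrightarrow> s i + int (Suc m) \<le> s j" for s
    proof -
      have "fo_sat (<) (Ex w (Conj (Less i w) \<phi>)) s \<longleftrightarrow> (\<exists>a. s i < a \<and> a + int m \<le> s j)"
        using w by (simp add: \<phi>)
      also have "\<dots> \<longleftrightarrow> s i + int (Suc m) \<le> s j"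
        by (auto intro!: exI[of _ "s i + 1"])
      finally show ?thesis .
    qed
    then show ?case unfolding expressible_def by blast
  qed
  show ?thesis
  proof (cases "k \<ge> 0")
    case True
    then show ?thesis using nonneg[of i "nat k" j] by simp
  next
    case False
    have "(\<lambda>s. \<not> s j + int (nat (1 - k)) \<le> s i) = (\<lambda>s. s i + k \<le> s j)"
      using False by (auto simp: fun_eq_iff)
    then show ?thesis using expressible_not[OF nonneg[of j "nat (1 - k)" i]] by simp
  qed
qed

text \<open>There are only finitely many patterns of comparisons with offsets in
  \<open>{-M..M}\<close>; the formula is the disjunction of the complete descriptions of those
  realized in \<open>X\<close>.\<close>

lemma invariant_definable:
  assumes len: "\<And>xs. xs \<in> X \<Longrightarrow> length xs = n"
    and inv: "\<And>xs ys. xs \<in> X \<Longrightarrow> length ys = n \<Longrightarrow>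
      (\<And>i j k. i < n \<Longrightarrow> j < n \<Longrightarrow> k \<in> {-M..M} \<Longrightarrow> xs ! i + k \<le> xs ! j \<longleftrightarrow> ys ! i + k \<le> ys ! j) \<Longrightarrow> ys \<in> X"
  obtains \<phi> where "fo_rel (<) (n, \<phi>) = (X :: int list set)"
proof -
  define A where "A = {..<n} \<times> {..<n} \<times> {-M..M}"
  define holds where "holds a s = (case a of (i, j, k) \<Rightarrow> s i + k \<le> s j)" for a and s :: "nat \<Rightarrow> int"
  define type where "type s = {a \<in> A. holds a s}" for s
  have "finite A" by (simp add: A_def)
  have "finite ((\<lambda>xs. type ((!) xs)) ` X)"
    by (rule finite_subset[of _ "Pow A"]) (auto simp: type_def \<open>finite A\<close>)
  moreover have "expressible (holds a)" for a
    by (cases a) (simp add: holds_def[abs_def] expressible_le)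
  ultimately have "expressible (\<lambda>s. \<exists>B\<in>(\<lambda>xs. type ((!) xs)) ` X. \<forall>a\<in>A. holds a s \<longleftrightarrow> a \<in> B)"
    by (intro expressible_bex expressible_ball expressible_eq_const \<open>finite A\<close>)
  then obtain \<phi> where \<phi>: "\<And>s. fo_sat (<) \<phi> s \<longleftrightarrow> (\<exists>xs\<in>X. \<forall>a\<in>A. holds a s \<longleftrightarrow> a \<in> type ((!) xs))"
    unfolding expressible_def by auto
  have "ys \<in> fo_rel (<) (n, \<phi>) \<longleftrightarrow> ys \<in> X" for ys
  proof
    assume "ys \<in> fo_rel (<) (n, \<phi>)"
    then obtain s where s: "length ys = n" "\<And>i. i < n \<Longrightarrow> s i = ys ! i" "fo_sat (<) \<phi> s"
      by (auto simp: fo_rel_def)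
    then obtain xs where xs: "xs \<in> X" "\<And>a. a \<in> A \<Longrightarrow> holds a s \<longleftrightarrow> a \<in> type ((!) xs)"
      unfolding \<phi> by blast
    show "ys \<in> X"
    proof (rule inv[OF xs(1) s(1)])
      fix i j k assume ijk: "i < n" "j < n" "k \<in> {-M..M}"
      then have "(i, j, k) \<in> A" by (simp add: A_def)
      with xs(2)[OF this] show "xs ! i + k \<le> xs ! j \<longleftrightarrow> ys ! i + k \<le> ys ! j"
        using s(2) ijk by (simp add: type_def holds_def)
    qed
  next
    assume "ys \<in> X"
    then have "fo_sat (<) \<phi> ((!) ys)" unfolding \<phi> by (intro bexI[of _ ys]) (auto simp: type_def)
    then show "ys \<in> fo_rel (<) (n, \<phi>)" using len[OF \<open>ys \<in> X\<close>] by (auto simp: fo_rel_def)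
  qed
  then show thesis using that by blast
qed

lemma mult_le_iff_le_div: "d \<ge> 1 \<Longrightarrow> d * a \<le> b \<longleftrightarrow> a \<le> b div (d::int)"
  by (smt (verit, ccfv_SIG) div_mult_mod_eq mult.commute mult_less_cancel_left_pos pos_mod_bound pos_mod_sign
      nonzero_mult_div_cancel_left zdiv_mono1)

lemma scaled_relation_definable:
  fixes d :: int
  assumes d: "d \<ge> 1"
  obtains \<psi> where "fo_rel (<) (n, \<psi>) = {t. map ((*) d) t \<in> fo_rel (<) (n, \<phi>)}"
proof -
  define M where "M = diff_bound (n, \<phi>)"
  show thesis
  proof (rule invariant_definable[where n=n and M=M and X="{t. map ((*) d) t \<in> fo_rel (<) (n, \<phi>)}"])
    show "length xs = n" if "xs \<in> {t. map ((*) d) t \<in> fo_rel (<) (n, \<phi>)}" for xs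
      using that by (auto simp: fo_rel_def)
    fix xs ys :: "int list"
    assume xs: "xs \<in> {t. map ((*) d) t \<in> fo_rel (<) (n, \<phi>)}" and ys: "length ys = n"
      and inv: "\<And>i j k. i < n \<Longrightarrow> j < n \<Longrightarrow> k \<in> {-M..M} \<Longrightarrow> xs ! i + k \<le> xs ! j \<longleftrightarrow> ys ! i + k \<le> ys ! j"
    have len: "length xs = n" using xs by (auto simp: fo_rel_def)
    have "map ((*) d) xs \<in> fo_rel (int_le 1) (n, \<phi>) \<longleftrightarrow> map ((*) d) ys \<in> fo_rel (int_le 1) (n, \<phi>)"
    proof (rule fo_rel_transfer[OF int.shift_chain_axioms int.shift_chain_axioms int_le_eq int_le_eq])
      fix i j k assume ij: "i < length (map ((*) d) xs)" "j < length (map ((*) d) xs)"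
        and k: "k \<in> {- diff_bound (n, \<phi>)..diff_bound (n, \<phi>)}"
      \<comment> \<open>This is \<open>k / d\<close> rounded up. Its absolute value is at most that
        of \<open>k\<close>, so the bound \<open>M\<close> of the original formula also serves the
        scaled relation.\<close>
      define c where "c = - ((- k) div d)"
      have c: "d * x + k \<le> d * y \<longleftrightarrow> x + c \<le> y" for x y
        using mult_le_iff_le_div[OF d, of "x - y" "- k"] by (auto simp: c_def algebra_simps)
      have "- \<bar>k\<bar> \<le> (- k) div d"
      proof -
        have "\<bar>k\<bar> * 1 \<le> \<bar>k\<bar> * d" using d by (intro mult_left_mono) auto
        then have "d * (- \<bar>k\<bar>) \<le> - k" by (simp add: mult.commute)
        then show ?thesis using mult_le_iff_le_div[OF d] by blast
      qed
      moreover have "(- k) div d \<le> \<bar>k\<bar>"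
      proof (rule ccontr)
        assume "\<not> (- k) div d \<le> \<bar>k\<bar>"
        then have upper: "d * (\<bar>k\<bar> + 1) \<le> - k" using mult_le_iff_le_div[OF d, of "\<bar>k\<bar> + 1"] by simp
        have "1 * (\<bar>k\<bar> + 1) \<le> d * (\<bar>k\<bar> + 1)" using d by (intro mult_right_mono) auto
        from order_trans[OF this upper] show False by simp
      qed
      ultimately have "c \<in> {-M..M}" using k by (auto simp: c_def M_def)
      from inv[OF _ _ this] ij len ys
      show "int_le k (map ((*) d) xs ! i) (map ((*) d) xs ! j) \<longleftrightarrow>
          int_le k (map ((*) d) ys ! i) (map ((*) d) ys ! j)"
        by (simp add: int_le_def c)
    qed (simp add: len ys)
    then show "ys \<in> {t. map ((*) d) t \<in> fo_rel (<) (n, \<phi>)}" using xs by (simp add: less_int_le)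
  qed (use that in blast)
qed

lemma scaled_reduct:
  assumes d: "d \<ge> 1"
  obtains \<Psi> where "sig \<Psi> = sig \<Phi>" "\<And>i. i < length \<Phi> \<Longrightarrow> rel \<Psi> i = {t. map ((*) d) t \<in> rel \<Phi> i}"
proof -
  have "\<exists>\<psi>. fo_rel (<) (fst a, \<psi>) = {t. map ((*) d) t \<in> fo_rel (<) a}" for a
    using scaled_relation_definable[OF d, of "fst a" "snd a"] by (metis prod.collapse)
  then obtain \<psi> where \<psi>: "\<And>a. fo_rel (<) (fst a, \<psi> a) = {t. map ((*) d) t \<in> fo_rel (<) a}" by metis
  let ?\<Psi> = "map (\<lambda>a. (fst a, \<psi> a)) \<Phi>"
  have "sig ?\<Psi> = sig \<Phi>" by (simp add: sig_def)
  moreover have "rel ?\<Psi> i = {t. map ((*) d) t \<in> rel \<Phi> i}" if "i < length \<Phi>" for i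
    using that \<psi> by (simp add: rel_def)
  ultimately show thesis by (rule that)
qed

section \<open>Homomorphic equivalence and primitive positive definability of orbits\<close>

lemma zstruct_rel: "zstruct \<Phi> = (UNIV, \<lambda>i. if i < length \<Phi> then rel \<Phi> i else {})"
  by (simp add: zstruct_def rel_def fun_eq_iff)

lemma length_sig [simp]: "length (sig \<Phi>) = length \<Phi>" by (simp add: sig_def)

lemma length_rel: "t \<in> rel \<Phi> i \<Longrightarrow> i < length \<Phi> \<Longrightarrow> length t = sig \<Phi> ! i"
  by (auto simp: rel_def fo_rel_def sig_def)

lemma pp_true_hom:
  assumes "wf_pp \<tau> \<phi>" "\<And>x. x \<in> fst A \<Longrightarrow> h x \<in> fst B"
    and hom: "\<And>i t. i < length \<tau> \<Longrightarrow> t \<in> snd A i \<Longrightarrow> map h t \<in> snd B i" and "pp_true A \<phi>"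
  shows "pp_true B \<phi>"
proof -
  from assms(4) obtain s where s: "range s \<subseteq> fst A" "pp_holds A \<phi> s" by (auto simp: pp_true_def)
  have "map (h \<circ> s) vs \<in> snd B i" if "(i, vs) \<in> set (fst \<phi>)" for i vs
    using hom[of i "map s vs"] that s(2) assms(1) by (fastforce simp: pp_holds_def wf_pp_def)
  then have "pp_holds B \<phi> (h \<circ> s)" using s(2) by (auto simp: pp_holds_def)
  then show ?thesis unfolding pp_true_def using s(1) assms(2) by (intro exI[of _ "h \<circ> s"]) auto
qed

text \<open>Taking images of the relations makes \<open>f\<close> a homomorphism onto its range, and
  the inclusion is a homomorphism back because \<open>f\<close> is an endomorphism. The encoding by
  \<open>to_nat\<close> only renames points.\<close>

lemma finite_range_imp_finite_template:
  assumes f: "f \<in> endos \<Phi>" and fin: "finite (range f)"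
  shows "\<exists>\<Delta> :: nat struct. finite (fst \<Delta>) \<and> fst \<Delta> \<noteq> {} \<and> wf_struct (sig \<Phi>) \<Delta> \<and>
    same_csp (sig \<Phi>) (zstruct \<Phi>) \<Delta>"
proof -
  define h where "h x = to_nat (f x)" for x
  define \<Delta> :: "nat struct" where
    "\<Delta> = (range h, \<lambda>i. if i < length \<Phi> then map h ` rel \<Phi> i else {})"
  have "range h = to_nat ` range f" by (auto simp: h_def)
  then have "finite (fst \<Delta>)" using fin by (simp add: \<Delta>_def)
  moreover have "fst \<Delta> \<noteq> {}" by (simp add: \<Delta>_def)
  moreover have "wf_struct (sig \<Phi>) \<Delta>" by (auto simp: wf_struct_def \<Delta>_def length_rel)
  moreover have "pp_true (zstruct \<Phi>) \<phi> \<longleftrightarrow> pp_true \<Delta> \<phi>" if wf: "wf_pp (sig \<Phi>) \<phi>" for \<phi>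
  proof
    show "pp_true \<Delta> \<phi>" if "pp_true (zstruct \<Phi>) \<phi>"
      by (rule pp_true_hom[OF wf _ _ that, of h]) (auto simp: \<Delta>_def zstruct_rel)
    show "pp_true (zstruct \<Phi>) \<phi>" if "pp_true \<Delta> \<phi>"
    proof (rule pp_true_hom[OF wf _ _ that, of from_nat])
      fix i t assume "i < length (sig \<Phi>)" "t \<in> snd \<Delta> i"
      then obtain u where i: "i < length \<Phi>" and u: "u \<in> rel \<Phi> i" "t = map h u" by (auto simp: \<Delta>_def)
      have "map from_nat t = map f u" by (simp add: u h_def)
      then show "map from_nat t \<in> snd (zstruct \<Phi>) i" using f u(1) i by (simp add: zstruct_rel endos_def)
    qed (simp add: zstruct_rel)
  qed
  ultimately show ?thesis unfolding same_csp_def by blast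
qed

text \<open>By compactness there is an \<open>n\<close> such that homomorphisms on the window
  \<open>{-n..n}\<close> realize no differences between \<open>0\<close> and \<open>j\<close> beyond
  those of endomorphisms. Being such a homomorphism is a finite conjunction of atoms, the positive
  diagram of the window.\<close>

lemma endo_orbit_pp_definable:
  assumes lim: "\<And>F. (\<And>n. partial_hom \<Psi> n (F n)) \<Longrightarrow> \<exists>f\<in>endos \<Psi>. \<exists>n. F n j - F n 0 = f j - f 0"
  shows "pp_definable (sig \<Psi>) (zstruct \<Psi>) 2 {[f 0, f j] | f. f \<in> endos \<Psi>}"
proof -
  have "\<exists>n. \<forall>h. partial_hom \<Psi> n h \<longrightarrow> (\<exists>f\<in>endos \<Psi>. h j - h 0 = f j - f 0)"
  proof (rule ccontr)
    assume "\<not> ?thesis"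
    then obtain F where "\<And>n. partial_hom \<Psi> n (F n)" "\<And>n. \<not> (\<exists>f\<in>endos \<Psi>. F n j - F n 0 = f j - f 0)"
      by metis
    with lim[of F] show False by blast
  qed
  then obtain n where n: "\<And>h. partial_hom \<Psi> n h \<Longrightarrow> \<exists>f\<in>endos \<Psi>. h j - h 0 = f j - f 0" by blast
  \<comment> \<open>Variables 0 and 1 are reserved for the defined pair.\<close>
  define var where "var z = to_nat z + 2" for z :: int
  let ?T = "\<lambda>i. {t \<in> rel \<Psi> i. set t \<subseteq> {- int n..int n}}"
  define atoms where "atoms = (SIGMA i:{..<length \<Psi>}. map var ` ?T i)"
  have "finite (?T i)" if "i < length \<Psi>" for i
    by (rule finite_subset[OF _ finite_lists_length_eq[of "{- int n..int n}" "sig \<Psi> ! i"]])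
      (auto simp: length_rel that)
  then have "finite atoms" unfolding atoms_def by (intro finite_SigmaI finite_imageI) auto
  then obtain al where al: "set al = atoms" using finite_list by blast
  define \<phi> :: ppf where "\<phi> = (al, [(0, var 0), (1, var j)])"
  have wf: "wf_pp (sig \<Psi>) \<phi>" by (auto simp: wf_pp_def \<phi>_def al atoms_def length_rel)
  have holds: "pp_holds (zstruct \<Psi>) \<phi> s \<longleftrightarrow>
      partial_hom \<Psi> n (s \<circ> var) \<and> s 0 = s (var 0) \<and> s 1 = s (var j)" for s
    by (auto simp: pp_holds_def \<phi>_def al atoms_def zstruct_rel partial_hom_def)
  have two: "[0..<2] = [0, 1]" by (simp add: upt_conv_Cons)
  have "{[f 0, f j] | f. f \<in> endos \<Psi>} = {map s [0..<2] | s. range s \<subseteq> fst (zstruct \<Psi>) \<and> pp_holds (zstruct \<Psi>) \<phi> s}"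
    (is "?L = ?R")
  proof (intro equalityI subsetI)
    fix x assume "x \<in> ?L"
    then obtain f where f: "f \<in> endos \<Psi>" "x = [f 0, f j]" by blast
    define s where "s v = (if v = 0 then f 0 else if v = 1 then f j else f (from_nat (v - 2)))" for v
    have sv: "s (var z) = f z" for z by (simp add: s_def var_def)
    then have "partial_hom \<Psi> n (s \<circ> var)" using f(1) by (simp add: partial_hom_def endos_def o_def)
    then have "pp_holds (zstruct \<Psi>) \<phi> s" unfolding holds sv by (simp add: s_def)
    moreover have "x = map s [0..<2]" unfolding two f(2) by (simp add: s_def)
    ultimately show "x \<in> ?R" by (auto simp: zstruct_rel)
  next
    fix x assume "x \<in> ?R"
    then obtain s where s: "x = [s 0, s 1]" "pp_holds (zstruct \<Psi>) \<phi> s" unfolding two by auto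
    then obtain f where f: "f \<in> endos \<Psi>" "(s \<circ> var) j - (s \<circ> var) 0 = f j - f 0"
      unfolding holds using n by blast
    \<comment> \<open>So far only the differences match; the translation makes the values match
      too.\<close>
    define g where "g z = f z + (s 0 - f 0)" for z
    have "map g t \<in> rel \<Psi> i" if "i < length \<Psi>" "t \<in> rel \<Psi> i" for i t
    proof -
      have "map (\<lambda>x. x + (s 0 - f 0)) (map f t) \<in> rel \<Psi> i"
        unfolding rel_translate using f(1) that by (simp add: endos_def)
      then show ?thesis by (simp add: g_def[abs_def] o_def)
    qed
    then have "g \<in> endos \<Psi>" by (simp add: endos_def)
    moreover have "x = [g 0, g j]" using s f(2) unfolding holds by (simp add: g_def)
    ultimately show "x \<in> ?L" by blast
  qed
  then show ?thesis unfolding pp_definable_def using wf by blast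
qed

theorem mainTheorem12:
  fixes \<Phi> :: "(nat \<times> fo) list"
  assumes "has_rank \<Phi> 1"
  shows "(\<exists>\<Delta> :: nat struct. finite (fst \<Delta>) \<and> fst \<Delta> \<noteq> {} \<and> wf_struct (sig \<Phi>) \<Delta> \<and>
            same_csp (sig \<Phi>) (zstruct \<Phi>) \<Delta>)
       \<or> (\<exists>\<Psi>. sig \<Psi> = sig \<Phi> \<and> same_csp (sig \<Phi>) (zstruct \<Phi>) (zstruct \<Psi>) \<and>
            (\<forall>k \<ge> 1. pp_definable (sig \<Psi>) (zstruct \<Psi>) 2 (Dist k)))
       \<or> (\<exists>\<Psi>. sig \<Psi> = sig \<Phi> \<and> same_csp (sig \<Phi>) (zstruct \<Phi>) (zstruct \<Psi>) \<and>
            pp_definable (sig \<Psi>) (zstruct \<Psi>) 2 suc_rel)"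
proof -
  have rank: "q_endo \<Phi> e \<Longrightarrow> k_bounded 1 e" for e using assms by (simp add: has_rank_def)
  interpret compact_monoid "endos \<Phi>" by (rule endos_compact_monoid[OF rank])
  show ?thesis
  proof (cases rule: finite_range_or_core)
    case (finite f)
    then show ?thesis using finite_range_imp_finite_template by blast
  next
    case (core d p)
    obtain \<Psi> where \<Psi>: "sig \<Psi> = sig \<Phi>" "\<And>i. i < length \<Phi> \<Longrightarrow> rel \<Psi> i = {t. map ((*) d) t \<in> rel \<Phi> i}"
      using scaled_reduct[OF core(1)] by blast
    have len: "length \<Psi> = length \<Phi>" using \<Psi>(1) by (metis length_sig)
    \<comment> \<open>\<open>P\<close> and multiplication by \<open>d\<close> will be homomorphisms
      in opposite directions between the two structures, with \<open>P\<close> a left inverse of the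
      multiplication.\<close>
    define P where "P z = p z div d" for z
    have dP: "d * P z = p z" for z using core(3)[of z] by (simp add: P_def)
    have Pd: "P (d * z) = z" for z using core(1) by (simp add: P_def core(4))
    have up: "map ((*) d) t \<in> rel \<Phi> i" if "i < length \<Phi>" "t \<in> rel \<Psi> i" for i t
      using that \<Psi>(2) by simp
    have down: "map P t \<in> rel \<Psi> i" if "i < length \<Phi>" "t \<in> rel \<Phi> i" for i t
    proof -
      have "map ((*) d) (map P t) = map p t" by (simp add: dP)
      then show ?thesis using that core(2) \<Psi>(2) by (simp add: endos_def del: map_map)
    qed
    have csp: "same_csp (sig \<Phi>) (zstruct \<Phi>) (zstruct \<Psi>)"
      unfolding same_csp_def
    proof (intro allI impI iffI)
      fix \<phi> assume wf: "wf_pp (sig \<Phi>) \<phi>"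
      show "pp_true (zstruct \<Psi>) \<phi>" if "pp_true (zstruct \<Phi>) \<phi>"
        by (rule pp_true_hom[OF wf _ _ that, of P]) (use down len in \<open>auto simp: zstruct_rel\<close>)
      show "pp_true (zstruct \<Phi>) \<phi>" if "pp_true (zstruct \<Psi>) \<phi>"
        by (rule pp_true_hom[OF wf _ _ that, of "(*) d"]) (use up len in \<open>auto simp: zstruct_rel\<close>)
    qed
    have lift: "(\<lambda>x. P (f (d * x))) \<in> endos \<Psi>" if "f \<in> endos \<Phi>" for f
      unfolding endos_def
    proof (intro CollectI allI impI ballI)
      fix i t assume "i < length \<Psi>" "t \<in> rel \<Psi> i"
      then have "map P (map f (map ((*) d) t)) \<in> rel \<Psi> i"
        using up down that len by (simp add: endos_def del: map_map)
      then show "map (\<lambda>x. P (f (d * x))) t \<in> rel \<Psi> i" by (simp add: o_def)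
    qed
    \<comment> \<open>Conjugating \<open>g\<close> gives an endomorphism of the original structure
      with all values divisible by \<open>d\<close>.\<close>
    have isometry: "(\<forall>x. g x = g 0 + x) \<or> (\<forall>x. g x = g 0 - x)" if g: "g \<in> endos \<Psi>" for g
    proof -
      have "(\<lambda>z. d * g (P z)) \<in> endos \<Phi>"
        unfolding endos_def
      proof (intro CollectI allI impI ballI)
        fix i t assume "i < length \<Phi>" "t \<in> rel \<Phi> i"
        then have "map ((*) d) (map g (map P t)) \<in> rel \<Phi> i"
          using up down g len by (simp add: endos_def del: map_map)
        then show "map (\<lambda>z. d * g (P z)) t \<in> rel \<Phi> i" by (simp add: o_def)
      qed
      from core(5)[OF this] have "(\<forall>x. d * g x = d * (g 0 + x)) \<or> (\<forall>x. d * g x = d * (g 0 - x))"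
        using Pd[of 0] by (simp add: Pd distrib_left right_diff_distrib)
      then show ?thesis using core(1) by simp
    qed
    \<comment> \<open>Rank one is given for \<open>\<Phi>\<close>, not for \<open>\<Psi>\<close>, so
      the partial homomorphisms are carried to \<open>\<Phi>\<close> and the limit is brought back
      by \<open>P\<close>. The window grows to size \<open>N m\<close> because \<open>P\<close> may
      move points outwards.\<close>
    have lim: "\<exists>f\<in>endos \<Psi>. \<exists>n. F n j - F n 0 = f j - f 0" if F: "\<And>n. partial_hom \<Psi> n (F n)" for F j
    proof -
      have "\<exists>N. \<forall>z\<in>{- int m..int m}. \<bar>P z\<bar> \<le> int N" for m
      proof -
        have "finite ((\<lambda>z. nat \<bar>P z\<bar>) ` {- int m..int m})" by simp
        then obtain N where "\<forall>a\<in>(\<lambda>z. nat \<bar>P z\<bar>) ` {- int m..int m}. a \<le> N"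
          using finite_nat_set_iff_bounded_le by blast
        then show ?thesis by (intro exI[of _ N]) auto
      qed
      then obtain N where N: "\<And>m z. z \<in> {- int m..int m} \<Longrightarrow> \<bar>P z\<bar> \<le> int (N m)" by metis
      have ph: "partial_hom \<Phi> m (\<lambda>z. d * F (N m) (P z))" for m
        unfolding partial_hom_def
      proof (intro allI impI ballI)
        fix i t assume i: "i < length \<Phi>" and t: "t \<in> rel \<Phi> i" "set t \<subseteq> {- int m..int m}"
        have "P z \<in> {- int (N m)..int (N m)}" if "z \<in> set t" for z
          using N[of z m] t(2) that by (simp add: abs_le_iff subset_iff)
        then have "set (map P t) \<subseteq> {- int (N m)..int (N m)}" by auto
        then have "map (F (N m)) (map P t) \<in> rel \<Psi> i"
          using F[of "N m"] down[OF i t(1)] i len unfolding partial_hom_def by metis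
        from up[OF i this] show "map (\<lambda>z. d * F (N m) (P z)) t \<in> rel \<Phi> i" by (simp add: o_def)
      qed
      obtain f and r :: "nat \<Rightarrow> nat" where f: "f \<in> endos \<Phi>" "strict_mono r"
        "\<And>u v. \<forall>\<^sub>F n in sequentially. d * F (N (r n)) (P u) - d * F (N (r n)) (P v) = f u - f v"
        by (rule limit_endomorphism[OF rank ph], assumption) (rule that)
      from f(3)[of "d * j" "d * 0"] obtain n where
        n: "d * F n j - d * F n 0 = f (d * j) - f (d * 0)"
        unfolding Pd eventually_sequentially by blast
      \<comment> \<open>The limit \<open>f\<close> need not preserve the multiples of
        \<open>d\<close>. Subtracting \<open>f 0\<close> makes the arguments of \<open>P\<close> at
        \<open>0\<close> and \<open>j\<close> multiples of \<open>d\<close>, where \<open>P\<close>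
        divides by \<open>d\<close>.\<close>
      define g where "g x = P (f (d * x) + - f 0)" for x
      have "(\<lambda>x. f (x + 0) + - f 0) \<in> endos \<Phi>" by (rule shift_mem[OF f(1)])
      from lift[OF this] have "g \<in> endos \<Psi>" by (simp add: g_def[abs_def])
      moreover have "g j = F n j - F n 0" "g 0 = 0"
        using Pd[of "F n j - F n 0"] Pd[of 0] n by (simp_all add: g_def algebra_simps)
      ultimately show ?thesis by (metis diff_zero)
    qed
    have orbit: "pp_definable (sig \<Psi>) (zstruct \<Psi>) 2 {[f 0, f j] | f. f \<in> endos \<Psi>}" for j
      by (rule endo_orbit_pp_definable) (rule lim)
    have trans: "(\<lambda>x. x + c) \<in> endos \<Psi>" for c by (simp add: endos_def rel_translate)
    \<comment> \<open>If a reflection is present, the endomorphisms are all the isometries of the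
      integers and the orbits of pairs are the sets \<open>Dist k\<close>; otherwise they are
      exactly the translations.\<close>
    show ?thesis
    proof (cases "\<exists>g\<in>endos \<Psi>. \<forall>x. g x = g 0 - x")
      case True
      then obtain g where g: "g \<in> endos \<Psi>" "\<And>x. g x = g 0 - x" by blast
      have refl: "(\<lambda>x. c - x) \<in> endos \<Psi>" for c
      proof -
        have "map (\<lambda>x. c - x) t \<in> rel \<Psi> i" if "i < length \<Psi>" "t \<in> rel \<Psi> i" for i t
        proof -
          have "map (\<lambda>x. x + (c - g 0)) (map g t) \<in> rel \<Psi> i"
            unfolding rel_translate using g(1) that by (simp add: endos_def)
          moreover have "(\<lambda>x. x + (c - g 0)) \<circ> g = (\<lambda>x. c - x)"
          proof
            fix x show "((\<lambda>x. x + (c - g 0)) \<circ> g) x = c - x" using g(2)[of x] by simp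
          qed
          ultimately show ?thesis by simp
        qed
        then show ?thesis by (simp add: endos_def)
      qed
      have dist: "{[f 0, f (int k)] | f. f \<in> endos \<Psi>} = Dist k" for k
      proof (intro equalityI subsetI)
        fix x assume "x \<in> {[f 0, f (int k)] | f. f \<in> endos \<Psi>}"
        then obtain f where f: "f \<in> endos \<Psi>" "x = [f 0, f (int k)]" by blast
        have "\<bar>f 0 - f (int k)\<bar> = int k" using isometry[OF f(1)] by (metis abs_minus_commute abs_of_nat add_diff_cancel_left' diff_add_cancel)
        then show "x \<in> Dist k" using f(2) by (auto simp: Dist_def)
      next
        fix x assume "x \<in> Dist k"
        then obtain a b where ab: "x = [a, b]" "\<bar>a - b\<bar> = int k" by (auto simp: Dist_def)
        then consider "b = int k + a" | "b = a - int k" by linarith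
        then show "x \<in> {[f 0, f (int k)] | f. f \<in> endos \<Psi>}"
        proof cases
          case 1
          then show ?thesis using ab(1) trans[of a] by (intro CollectI exI[of _ "\<lambda>x. x + a"]) simp
        next
          case 2
          then show ?thesis using ab(1) refl[of a] by (intro CollectI exI[of _ "\<lambda>x. a - x"]) simp
        qed
      qed
      have "pp_definable (sig \<Psi>) (zstruct \<Psi>) 2 (Dist k)" for k
        using orbit[of "int k"] unfolding dist .
      then show ?thesis using \<Psi>(1) csp by blast
    next
      case False
      have suc: "{[f 0, f 1] | f. f \<in> endos \<Psi>} = suc_rel"
      proof (intro equalityI subsetI)
        fix x assume "x \<in> {[f 0, f 1] | f. f \<in> endos \<Psi>}"
        then obtain f where f: "f \<in> endos \<Psi>" "x = [f 0, f 1]" by blast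
        have "f 1 = f 0 + 1" using isometry[OF f(1)] False f(1) by blast
        then show "x \<in> suc_rel" using f(2) by (auto simp: suc_rel_def)
      next
        fix x assume "x \<in> suc_rel"
        then obtain a where "x = [a, a + 1]" by (auto simp: suc_rel_def)
        then show "x \<in> {[f 0, f 1] | f. f \<in> endos \<Psi>}"
          using trans[of a] by (intro CollectI exI[of _ "\<lambda>x. x + a"]) (simp add: add.commute)
      qed
      have "pp_definable (sig \<Psi>) (zstruct \<Psi>) 2 suc_rel" using orbit[of 1] unfolding suc .
      then show ?thesis using \<Psi>(1) csp by blast
    qed
  qed
qed

end
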